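(* Let $L>0$ and let $f\in PW_L$. Let $a\in\mathbb{C}$ with $\operatorname{Im}a>0$ and put $\beta_a=\dfrac{2\operatorname{Im}a}{|a|^2}$. Then $$\Big|\inf_{|c|=1}\|\mathfrak{F}_af-cf\|_2^2-2\|f\|_2^2\Big|\leq 30\,(L\operatorname{Im}a)\,\|f\|_2^2\qquad\text{if }\beta_a>2L,$$ and $$\inf_{|c|=1}\|\mathfrak{F}_af-cf\|_2^2\leq 2\,\omega_2(\widehat f;\beta_a)\,\|f\|_2+8\sqrt{L\operatorname{Im}a}\,\|f\|_2^2\qquad\text{if }\beta_a\leq 2L,$$ where the infima are over all $c\in\mathbb{C}$ with $|c|=1$.
   Context: $\|\cdot\|_2$ is the norm of $L^2(\mathbb{R})$ (complex-valued functions). The Fourier transform is normalized by $\widehat f(w)=\frac{1}{\sqrt{2\pi}}\int_{\mathbb{R}}f(x)e^{-iwx}\,dx$, extended unitarily to $L^2(\mathbb{R})$. For $L>0$, $PW_L$ (Paley-Wiener class) is the space of $f\in L^2(\mathbb{R})$ with $\operatorname{supp}\widehat f\subseteq[-L,L]$. For $a\in\mathbb{C}$ with $\operatorname{Im}a>0$, the flipping operator is $$(\mathfrak{F}_af)(x)=\frac{1-x/\bar a}{1-x/a}\cdot\frac{e^{x/\bar a}}{e^{x/a}}\,f(x),\qquad x\in\mathbb{R}.$$ It is defined whether or not $f$ vanishes at $a$, and $|\mathfrak{F}_af|=|f|$ on $\mathbb{R}$. For $F\in L^2(\mathbb{R})$ and $h>0$, the $L^2$-modulus of continuity is $$\omega_2(F;h)=\sup_{|\eta|\leq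 h}\left(\int_{\mathbb{R}}|F(x-\eta)-F(x)|^2\,dx\right)^{1/2}.$$ *)

theory Defs
  imports "HOL-Analysis.Analysis"
begin

text \<open>
  Elements of \<open>L\<^sup>2(\<real>)\<close> are represented by square-integrable Lebesgue measurable functions; everything
  below that takes such a function depends only on its almost-everywhere class.
\<close>

definition L2 :: "(real \<Rightarrow> complex) set" where
  "L2 = {f \<in> borel_measurable lebesgue. integrable lebesgue (\<lambda>x. (cmod (f x))\<^sup>2)}"

text \<open>Only meaningful on \<^const>\<open>L2\<close>: the Bochner integral of a non-integrable function is 0.\<close>

definition L2_norm :: "(real \<Rightarrow> complex) \<Rightarrow> real" where
  "L2_norm f = sqrt (LINT x|lebesgue. (cmod (f x))\<^sup>2)"

definition fourier_L1 :: "(real \<Rightarrow> complex) \<Rightarrow> real \<Rightarrow> complex" where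
  "fourier_L1 f w =
     complex_of_real (1 / sqrt (2 * pi)) *
     (LINT x|lebesgue. f x * exp (- \<i> * complex_of_real w * complex_of_real x))"

text \<open>
  The graph of the unitary extension of the Fourier transform: the closure in \<open>L\<^sup>2 \<times> L\<^sup>2\<close> of the graph
  of the integral transform on \<open>L\<^sup>1 \<inter> L\<^sup>2\<close>. By Plancherel's theorem every \<open>f\<close> in \<open>L\<^sup>2\<close> has such a
  transform \<open>g\<close>, unique up to null sets, so the choice in \<open>fourier_L2\<close> only picks a representative.
\<close>

definition is_fourier_L2 :: "(real \<Rightarrow> complex) \<Rightarrow> (real \<Rightarrow> complex) \<Rightarrow> bool" where
  "is_fourier_L2 f g \<longleftrightarrow> f \<in> L2 \<and> g \<in> L2 \<and>
     (\<exists>u :: nat \<Rightarrow> real \<Rightarrow> complex.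
        (\<forall>n. u n \<in> L2 \<and> integrable lebesgue (u n)) \<and>
        (\<forall>n. fourier_L1 (u n) \<in> L2) \<and>
        (\<lambda>n. L2_norm (\<lambda>x. u n x - f x)) \<longlonglongrightarrow> 0 \<and>
        (\<lambda>n. L2_norm (\<lambda>w. fourier_L1 (u n) w - g w)) \<longlonglongrightarrow> 0)"

definition fourier_L2 :: "(real \<Rightarrow> complex) \<Rightarrow> real \<Rightarrow> complex" where
  "fourier_L2 f = (SOME g. is_fourier_L2 f g)"

text \<open>The support of an almost-everywhere class: the complement of the largest open set on which
  it vanishes almost everywhere.\<close>

definition ess_support :: "(real \<Rightarrow> complex) \<Rightarrow> real set" where
  "ess_support F = - \<Union>{U. open U \<and> (AE w in lebesgue. w \<in> U \<longrightarrow> F w = 0)}"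

definition PW :: "real \<Rightarrow> (real \<Rightarrow> complex) set" where
  "PW L = {f \<in> L2. ess_support (fourier_L2 f) \<subseteq> {-L..L}}"

definition flipping :: "complex \<Rightarrow> (real \<Rightarrow> complex) \<Rightarrow> real \<Rightarrow> complex" where
  "flipping a f x =
     (1 - complex_of_real x / cnj a) / (1 - complex_of_real x / a) *
     (exp (complex_of_real x / cnj a) / exp (complex_of_real x / a)) * f x"

text \<open>For \<open>F\<close> in \<^const>\<open>L2\<close> and \<open>h \<ge> 0\<close> the set of norms is nonempty and bounded by twice the norm of
  \<open>F\<close>, so the real supremum is the intended one.\<close>

definition modulus2 :: "(real \<Rightarrow> complex) \<Rightarrow> real \<Rightarrow> real" where
  "modulus2 F h = (SUP \<eta>\<in>{\<eta>. \<bar>\<eta>\<bar> \<le> h}. L2_norm (\<lambda>x. F (x - \<eta>) - F x))"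

end

theory Submission
  imports Defs "HOL-Probability.Probability"
begin

text \<open>
  Since \<open>|F\<^sub>a f| = |f|\<close>, expanding the square gives \<open>\<parallel>F\<^sub>a f - c f\<parallel>\<^sup>2 = 2 \<parallel>f\<parallel>\<^sup>2 - 2 Re (cnj c * \<integral> m |f|\<^sup>2)\<close> for
  the unimodular factor \<open>m(x) = (a / cnj a) e(x) (1 + 2 \<i> Im a / (x - a))\<close> with \<open>e(x) = exp (\<i> \<beta> x)\<close>.
  The integral thus splits into \<open>\<integral> e |f|\<^sup>2\<close>, which by Plancherel's theorem compares the Fourier transform
  of \<open>f\<close> with its translate by \<open>\<beta>\<close>, and a remainder. Writing \<open>1 / (x - a)\<close> as \<open>\<i> \<integral> exp (\<i> t (a - x)) dt\<close>
  over \<open>t > 0\<close>, the remainder becomes an integral of the Fourier coefficients of \<open>|f|\<^sup>2\<close> at the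
  frequencies \<open>\<beta> - t\<close>, damped by \<open>exp (- t Im a)\<close>. These coefficients are at most \<open>\<parallel>f\<parallel>\<^sup>2\<close> and vanish outside
  \<open>[-2L, 2L]\<close>, so the remainder is at most \<open>2 Im a * min (4L) (1 / Im a) * \<parallel>f\<parallel>\<^sup>2\<close>, which covers both regimes.

  Plancherel's theorem on \<open>L\<^sup>1 \<inter> L\<^sup>2\<close> comes from inserting a Gaussian factor into \<open>\<integral> |F u|\<^sup>2\<close>, which turns it into a
  Gaussian average of the autocorrelation of \<open>u\<close>, and from the continuity of translations in \<open>L\<^sup>2\<close>.
\<close>

section \<open>The space of square-integrable functions\<close>

lemma L2I: "f \<in> borel_measurable lebesgue \<Longrightarrow> integrable lebesgue (\<lambda>x. (cmod (f x))\<^sup>2) \<Longrightarrow> f \<in> L2"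
  by (simp add: L2_def)

lemma L2_measurable [measurable_dest]: "f \<in> L2 \<Longrightarrow> f \<in> borel_measurable lebesgue"
  by (simp add: L2_def)

lemma L2_integrable: "f \<in> L2 \<Longrightarrow> integrable lebesgue (\<lambda>x. (cmod (f x))\<^sup>2)"
  by (simp add: L2_def)

lemma L2_norm_nonneg [simp]: "L2_norm f \<ge> 0"
  by (simp add: L2_norm_def)

lemma L2_norm_power2: "(L2_norm f)\<^sup>2 = (LINT x|lebesgue. (cmod (f x))\<^sup>2)"
  by (simp add: L2_norm_def)

text \<open>The integral of \<open>(f - t g)^2\<close> is a nonnegative quadratic in
  \<open>t\<close>; its value at the minimizer \<open>t = C / B\<close> is the inequality, and
  \<open>B = 0\<close> forces \<open>g = 0\<close> almost everywhere. The measure is general because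
  both \<open>lebesgue\<close> and \<open>lborel\<close> occur below.\<close>

lemma integral_Cauchy_Schwarz:
  fixes f g :: "'a \<Rightarrow> real"
  assumes [measurable]: "f \<in> borel_measurable M" "g \<in> borel_measurable M"
    and f: "integrable M (\<lambda>x. (f x)\<^sup>2)" and g: "integrable M (\<lambda>x. (g x)\<^sup>2)"
  shows "integrable M (\<lambda>x. f x * g x)"
    and "(LINT x|M. f x * g x)\<^sup>2 \<le> (LINT x|M. (f x)\<^sup>2) * (LINT x|M. (g x)\<^sup>2)"
proof -
  have "\<bar>f x * g x\<bar> \<le> \<bar>(f x)\<^sup>2 + (g x)\<^sup>2\<bar>" for x
  proof -
    have "0 \<le> (\<bar>f x\<bar> - \<bar>g x\<bar>)\<^sup>2" by simp
    then have "2 * (\<bar>f x\<bar> * \<bar>g x\<bar>) \<le> (f x)\<^sup>2 + (g x)\<^sup>2"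
      by (simp add: power2_diff)
    moreover have "0 \<le> \<bar>f x\<bar> * \<bar>g x\<bar>" by simp
    ultimately show ?thesis
      unfolding abs_mult by linarith
  qed
  then show fg: "integrable M (\<lambda>x. f x * g x)"
    by (intro Bochner_Integration.integrable_bound[OF Bochner_Integration.integrable_add[OF f g]]) auto
  define A B C where "A = (LINT x|M. (f x)\<^sup>2)" and "B = (LINT x|M. (g x)\<^sup>2)"
    and "C = (LINT x|M. f x * g x)"
  have quad: "0 \<le> A - 2 * t * C + t\<^sup>2 * B" for t
  proof -
    have "0 \<le> (LINT x|M. (f x - t * g x)\<^sup>2)" by simp
    also have "\<dots> = (LINT x|M. (f x)\<^sup>2 - 2 * t * (f x * g x) + t\<^sup>2 * (g x)\<^sup>2)"
      by (rule Bochner_Integration.integral_cong) (auto simp: power2_eq_square algebra_simps)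
    also have "\<dots> = A - 2 * t * C + t\<^sup>2 * B"
      using f g fg by (simp add: A_def B_def C_def)
    finally show ?thesis .
  qed
  show "C\<^sup>2 \<le> A * B"
  proof (cases "B = 0")
    case True
    then have "AE x in M. (g x)\<^sup>2 = 0"
      using g integral_nonneg_eq_0_iff_AE[OF g] by (simp add: B_def)
    then have "C = (LINT x|M. 0)"
      unfolding C_def by (intro integral_cong_AE) auto
    then show ?thesis using True by simp
  next
    case False
    have "B \<ge> 0" by (simp add: B_def)
    with False have "B > 0" by simp
    with quad[of "C / B"] show ?thesis
      by (simp add: field_simps power2_eq_square)
  qed
qed

lemma norm_add_power2_le: "(norm (a + b))\<^sup>2 \<le> 2 * (norm a)\<^sup>2 + 2 * (norm (b :: 'a :: real_normed_vector))\<^sup>2"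
proof -
  have "(norm (a + b))\<^sup>2 \<le> (norm a + norm b)\<^sup>2"
    by (intro power_mono norm_triangle_ineq) auto
  also have "\<dots> \<le> 2 * (norm a)\<^sup>2 + 2 * (norm b)\<^sup>2"
    using zero_le_power2[of "norm a - norm b"] by (simp add: power2_sum power2_diff)
  finally show ?thesis .
qed

lemma L2_add: assumes "f \<in> L2" "g \<in> L2" shows "(\<lambda>x. f x + g x) \<in> L2"
proof (rule L2I)
  note [measurable] = assms[THEN L2_measurable]
  show "(\<lambda>x. f x + g x) \<in> borel_measurable lebesgue" by measurable
  have "integrable lebesgue (\<lambda>x. 2 * (cmod (f x))\<^sup>2 + 2 * (cmod (g x))\<^sup>2)"
    using assms[THEN L2_integrable] by simp
  then show "integrable lebesgue (\<lambda>x. (cmod (f x + g x))\<^sup>2)"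
    by (rule Bochner_Integration.integrable_bound) (auto intro!: norm_add_power2_le)
qed

lemma L2_mult_bounded:
  assumes f: "f \<in> L2" and [measurable]: "m \<in> borel_measurable lebesgue" and m: "\<And>x. cmod (m x) \<le> K"
  shows "(\<lambda>x. m x * f x) \<in> L2" "L2_norm (\<lambda>x. m x * f x) \<le> K * L2_norm f"
proof -
  note [measurable] = L2_measurable[OF f]
  have K: "K \<ge> 0" using m[of 0] norm_ge_zero[of "m 0"] by linarith
  have le: "(cmod (m x * f x))\<^sup>2 \<le> K\<^sup>2 * (cmod (f x))\<^sup>2" for x
    unfolding norm_mult power_mult_distrib by (intro mult_right_mono power_mono m) auto
  have int: "integrable lebesgue (\<lambda>x. K\<^sup>2 * (cmod (f x))\<^sup>2)"
    using L2_integrable[OF f] by simp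
  then have i: "integrable lebesgue (\<lambda>x. (cmod (m x * f x))\<^sup>2)"
    by (rule Bochner_Integration.integrable_bound) (use le in \<open>simp_all add: abs_mult\<close>)
  then show "(\<lambda>x. m x * f x) \<in> L2" by (intro L2I) auto
  have "(L2_norm (\<lambda>x. m x * f x))\<^sup>2 \<le> (K * L2_norm f)\<^sup>2"
    unfolding L2_norm_power2 power_mult_distrib
    using integral_mono[OF i int le] by simp
  then show "L2_norm (\<lambda>x. m x * f x) \<le> K * L2_norm f"
    using K by (elim power2_le_imp_le) simp
qed

lemma L2_cmult: "f \<in> L2 \<Longrightarrow> (\<lambda>x. c * f x) \<in> L2"
  by (rule L2_mult_bounded(1)[of f "\<lambda>_. c" "cmod c"]) auto

lemma L2_norm_cmult: "L2_norm (\<lambda>x. c * f x) = cmod c * L2_norm f"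
  by (simp add: L2_norm_def norm_mult power_mult_distrib real_sqrt_mult)

lemma L2_diff: "f \<in> L2 \<Longrightarrow> g \<in> L2 \<Longrightarrow> (\<lambda>x. f x - g x) \<in> L2"
  using L2_add[of f "\<lambda>x. (-1) * g x"] L2_cmult[of g "-1"] by simp

lemma L2_norm_cong_AE:
  assumes "AE x in lebesgue. f x = g x" "f \<in> borel_measurable lebesgue" "g \<in> borel_measurable lebesgue"
  shows "L2_norm f = L2_norm g"
  unfolding L2_norm_def using assms by (intro arg_cong[where f = sqrt] integral_cong_AE) auto

lemma L2_norm_triangle:
  assumes f: "f \<in> L2" and g: "g \<in> L2"
  shows "L2_norm (\<lambda>x. f x + g x) \<le> L2_norm f + L2_norm g"
proof -
  note [measurable] = assms[THEN L2_measurable]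
  note i = assms[THEN L2_integrable]
  have cs: "integrable lebesgue (\<lambda>x. cmod (f x) * cmod (g x))"
    "(LINT x|lebesgue. cmod (f x) * cmod (g x))\<^sup>2 \<le> (L2_norm f * L2_norm g)\<^sup>2"
    using integral_Cauchy_Schwarz[of "\<lambda>x. cmod (f x)" lebesgue "\<lambda>x. cmod (g x)"] i
    by (auto simp: power_mult_distrib L2_norm_power2)
  then have cs2: "(LINT x|lebesgue. cmod (f x) * cmod (g x)) \<le> L2_norm f * L2_norm g"
    by (rule_tac power2_le_imp_le) auto
  have "(L2_norm (\<lambda>x. f x + g x))\<^sup>2
      \<le> (LINT x|lebesgue. (cmod (f x))\<^sup>2 + 2 * (cmod (f x) * cmod (g x)) + (cmod (g x))\<^sup>2)"
    unfolding L2_norm_power2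
  proof (rule integral_mono)
    show "integrable lebesgue (\<lambda>x. (cmod (f x + g x))\<^sup>2)" by (rule L2_integrable[OF L2_add[OF f g]])
    show "integrable lebesgue (\<lambda>x. (cmod (f x))\<^sup>2 + 2 * (cmod (f x) * cmod (g x)) + (cmod (g x))\<^sup>2)"
      using i cs by simp
    show "(cmod (f x + g x))\<^sup>2 \<le> (cmod (f x))\<^sup>2 + 2 * (cmod (f x) * cmod (g x)) + (cmod (g x))\<^sup>2" for x
      using power_mono[OF norm_triangle_ineq[of "f x" "g x"], of 2] by (simp add: power2_sum)
  qed
  also have "\<dots> = (L2_norm f)\<^sup>2 + 2 * (LINT x|lebesgue. cmod (f x) * cmod (g x)) + (L2_norm g)\<^sup>2"
    using i cs by (simp add: L2_norm_power2)
  also have "\<dots> \<le> (L2_norm f + L2_norm g)\<^sup>2"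
    using cs2 by (simp add: power2_sum)
  finally show ?thesis by (rule power2_le_imp_le) simp
qed

lemma L2_norm_minus_commute: "L2_norm (\<lambda>x. f x - g x) = L2_norm (\<lambda>x. g x - f x)"
  by (simp add: L2_norm_def norm_minus_commute)

lemma L2_norm_triangle_diff:
  assumes "f \<in> L2" "g \<in> L2" shows "\<bar>L2_norm f - L2_norm g\<bar> \<le> L2_norm (\<lambda>x. f x - g x)"
  using L2_norm_triangle[OF L2_diff[OF assms] assms(2)]
    L2_norm_triangle[OF L2_diff[OF assms(2,1)] assms(1)] L2_norm_minus_commute[of f g]
  by simp

lemma L2_translate:
  assumes f: "f \<in> L2"
  shows "(\<lambda>x. f (x - s)) \<in> L2" "L2_norm (\<lambda>x. f (x - s)) = L2_norm f"
proof -
  have "(\<lambda>x. f (x - s)) \<in> borel_measurable lebesgue"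
    using borel_measurable_affine[of f 1 "-s"] L2_measurable[OF f] by simp
  moreover have "integrable lebesgue (\<lambda>x. (cmod (f (x - s)))\<^sup>2)"
    using lebesgue_integrable_real_affine[OF L2_integrable[OF f], of 1 "-s"] by simp
  ultimately show "(\<lambda>x. f (x - s)) \<in> L2" by (rule L2I)
  show "L2_norm (\<lambda>x. f (x - s)) = L2_norm f"
    unfolding L2_norm_def
    using lebesgue_integral_real_affine[of 1 "\<lambda>x. (cmod (f x))\<^sup>2" "-s"] by simp
qed

text \<open>The Fubini arguments below are carried out over \<open>lborel\<close> with Borel
  integrands, so Lebesgue measurable functions enter them through a Borel representative, found for
  the real and imaginary parts separately.\<close>

lemma lebesgue_ex_borel:
  fixes f :: "real \<Rightarrow> complex"
  assumes [measurable]: "f \<in> borel_measurable lebesgue"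
  obtains g where "g \<in> borel_measurable borel" "AE x in lebesgue. f x = g x"
proof -
  obtain r where r: "r \<in> borel_measurable lborel" "AE x in lborel. Re (f x) = r x"
    using completion_ex_borel_measurable_real[of "\<lambda>x. Re (f x)" lborel] by auto
  obtain i where i: "i \<in> borel_measurable lborel" "AE x in lborel. Im (f x) = i x"
    using completion_ex_borel_measurable_real[of "\<lambda>x. Im (f x)" lborel] by auto
  have [measurable]: "r \<in> borel_measurable borel" "i \<in> borel_measurable borel" using r i by simp_all
  have "AE x in lborel. f x = Complex (r x) (i x)"
    using r(2) i(2) by eventually_elim (simp add: complex_eq_iff)
  moreover have "(\<lambda>x. Complex (r x) (i x)) \<in> borel_measurable borel"
    unfolding Complex_eq by measurable
  ultimately show ?thesis by (intro that[OF _ AE_completion])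
qed

section \<open>Completeness of \<open>L2\<close>\<close>

lemma L2_nn_integral:
  "f \<in> L2 \<Longrightarrow> (\<integral>\<^sup>+x. ennreal ((cmod (f x))\<^sup>2) \<partial>lebesgue) = ennreal ((L2_norm f)\<^sup>2)"
  by (simp add: L2_norm_power2 nn_integral_eq_integral L2_integrable)

text \<open>Fatou's lemma bounds nonnegative integrals; this form turns such a bound into membership
  in \<open>L2\<close> and a norm estimate at once.\<close>

lemma L2_nn_integral_bound:
  assumes [measurable]: "f \<in> borel_measurable lebesgue"
    and le: "(\<integral>\<^sup>+x. ennreal ((cmod (f x))\<^sup>2) \<partial>lebesgue) \<le> ennreal (c\<^sup>2)" and c: "c \<ge> 0"
  shows "f \<in> L2" "L2_norm f \<le> c"
proof -
  have "integrable lebesgue (\<lambda>x. (cmod (f x))\<^sup>2)"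
    by (rule integrableI_bounded) (use le in \<open>auto intro: le_less_trans\<close>)
  then show L2: "f \<in> L2" by (intro L2I) auto
  have "(L2_norm f)\<^sup>2 \<le> c\<^sup>2"
    using le by (simp add: L2_nn_integral[OF L2])
  then show "L2_norm f \<le> c" using c by (rule power2_le_imp_le)
qed

text \<open>Along a subsequence with \<open>\<parallel>u\<^sub>k\<^sub>+\<^sub>1 - u\<^sub>k\<parallel>\<^sup>2 \<le> 8\<^sup>-\<^sup>k\<close> the integral of \<open>\<Sum>k. 4\<^sup>k |u\<^sub>k\<^sub>+\<^sub>1 - u\<^sub>k|\<^sup>2\<close> is finite, so
  almost everywhere \<open>|u\<^sub>k\<^sub>+\<^sub>1 - u\<^sub>k|\<close> is at most a constant times \<open>2\<^sup>-\<^sup>k\<close> and the subsequence converges.\<close>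

lemma L2_complete:
  assumes u: "\<And>n. u n \<in> L2"
    and cauchy: "\<And>e. e > 0 \<Longrightarrow> \<exists>N. \<forall>m\<ge>N. \<forall>n\<ge>N. L2_norm (\<lambda>x. u m x - u n x) < e"
  obtains g where "g \<in> L2" "(\<lambda>n. L2_norm (\<lambda>x. u n x - g x)) \<longlonglongrightarrow> 0"
proof -
  note [measurable] = u[THEN L2_measurable]
  have "\<exists>N. \<forall>k. \<forall>m\<ge>N k. \<forall>n\<ge>N k. L2_norm (\<lambda>x. u m x - u n x) < (1/8) ^ k"
    by (intro choice allI cauchy) simp
  then obtain N where N: "\<And>k m n. m \<ge> N k \<Longrightarrow> n \<ge> N k \<Longrightarrow> L2_norm (\<lambda>x. u m x - u n x) < (1/8) ^ k"
    by blast
  \<comment> \<open>The chosen \<open>N\<close> need not be monotone; its partial sums are, which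
    gives \<open>r j \<ge> N k\<close> for all \<open>j \<ge> k\<close>.\<close>
  define r where "r k = (\<Sum>i\<le>k. N i)" for k
  have rN: "r j \<ge> N k" if "j \<ge> k" for j k :: nat
    unfolding r_def using member_le_sum[of k "{..j}" N] that by simp
  define d where "d k x = u (r (Suc k)) x - u (r k) x" for k x
  have dL2: "d k \<in> L2" for k
    unfolding d_def by (intro L2_diff u)
  have dn: "(L2_norm (d k))\<^sup>2 \<le> (1/8) ^ k" for k
  proof -
    have "L2_norm (d k) < (1/8) ^ k"
      unfolding d_def by (intro N rN) auto
    then have "(L2_norm (d k))\<^sup>2 \<le> ((1/8) ^ k)\<^sup>2"
      by (intro power_mono) auto
    also have "\<dots> \<le> (1/8::real) ^ k"
      unfolding power_mult[symmetric] by (intro power_decreasing) auto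
    finally show ?thesis .
  qed
  note [measurable] = dL2[THEN L2_measurable]
  have "(\<integral>\<^sup>+x. (\<Sum>k. ennreal (4 ^ k * (cmod (d k x))\<^sup>2)) \<partial>lebesgue)
      = (\<Sum>k. \<integral>\<^sup>+x. ennreal (4 ^ k * (cmod (d k x))\<^sup>2) \<partial>lebesgue)"
    by (rule nn_integral_suminf) measurable
  also have "\<dots> = (\<Sum>k. ennreal (4 ^ k * (L2_norm (d k))\<^sup>2))"
    by (intro suminf_cong) (simp add: ennreal_mult nn_integral_cmult L2_nn_integral dL2)
  also have "\<dots> \<le> (\<Sum>k. ennreal ((1/2) ^ k))"
  proof (intro suminf_le ennreal_leI)
    fix k
    have "4 ^ k * (L2_norm (d k))\<^sup>2 \<le> 4 ^ k * (1/8) ^ k"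
      by (intro mult_left_mono dn) auto
    also have "\<dots> = (1/2 :: real) ^ k"
      by (simp flip: power_mult_distrib)
    finally show "4 ^ k * (L2_norm (d k))\<^sup>2 \<le> (1/2) ^ k" .
  qed auto
  also have "\<dots> = ennreal (\<Sum>k. (1/2) ^ k)"
    by (intro suminf_ennreal2 summable_geometric) auto
  finally have "(\<integral>\<^sup>+x. (\<Sum>k. ennreal (4 ^ k * (cmod (d k x))\<^sup>2)) \<partial>lebesgue) \<noteq> \<infinity>"
    by (auto simp: top_unique)
  then have "AE x in lebesgue. (\<Sum>k. ennreal (4 ^ k * (cmod (d k x))\<^sup>2)) \<noteq> \<infinity>"
    by (intro nn_integral_noteq_infinite) measurable
  then have conv: "AE x in lebesgue. convergent (\<lambda>k. u (r k) x)"
  proof eventually_elim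
    case (elim x)
    then have "summable (\<lambda>k. 4 ^ k * (cmod (d k x))\<^sup>2)"
      by (intro summable_suminf_not_top) auto
    then have "Bseq (\<lambda>k. 4 ^ k * (cmod (d k x))\<^sup>2)"
      by (intro convergent_imp_Bseq convergentI[of _ 0] summable_LIMSEQ_zero)
    then obtain K where K: "K > 0" "\<And>k. 4 ^ k * (cmod (d k x))\<^sup>2 \<le> K"
      by (auto simp: Bseq_def)
    have le: "cmod (d k x) \<le> sqrt K * (1/2) ^ k" for k
    proof -
      have "(2 ^ k * cmod (d k x))\<^sup>2 = 4 ^ k * (cmod (d k x))\<^sup>2"
        by (simp add: power_mult_distrib power2_eq_square flip: power_mult_distrib[of 2 2 k])
      also have "\<dots> \<le> K" by (rule K)
      finally have "2 ^ k * cmod (d k x) \<le> sqrt K"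
        by (rule real_le_rsqrt)
      then show ?thesis by (simp add: field_simps)
    qed
    have "summable (\<lambda>k. d k x)"
      by (rule summable_comparison_test'[OF summable_mult[OF summable_geometric]]) (use le in auto)
    then have "convergent (\<lambda>n. \<Sum>k<n. u (r (Suc k)) x - u (r k) x)"
      by (simp add: summable_iff_convergent d_def)
    then have "convergent (\<lambda>n. u (r n) x - u (r 0) x)"
      by (simp add: sum_lessThan_telescope[of "\<lambda>k. u (r k) x"])
    then show ?case
      using convergent_add[OF _ convergent_const[of "u (r 0) x"]] by fastforce
  qed
  define g where "g x = lim (\<lambda>k. u (r k) x)" for x
  have g_meas [measurable]: "g \<in> borel_measurable lebesgue"
    unfolding g_def by measurable
  have lim: "AE x in lebesgue. (\<lambda>k. u (r k) x) \<longlonglongrightarrow> g x"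
    using conv unfolding g_def by eventually_elim (simp add: convergent_LIMSEQ_iff)
  \<comment> \<open>Fatou's lemma for \<open>u n - u (r j)\<close> as \<open>j\<close> grows carries
    the Cauchy bound over to the limit \<open>g\<close>. It covers the whole sequence, not only the
    subsequence.\<close>
  have close: "(\<lambda>x. u n x - g x) \<in> L2 \<and> L2_norm (\<lambda>x. u n x - g x) \<le> (1/8) ^ k" if n: "n \<ge> N k" for n k
  proof -
    have "(\<integral>\<^sup>+x. ennreal ((cmod (u n x - g x))\<^sup>2) \<partial>lebesgue)
        = (\<integral>\<^sup>+x. liminf (\<lambda>j. ennreal ((cmod (u n x - u (r j) x))\<^sup>2)) \<partial>lebesgue)"
    proof (intro nn_integral_cong_AE, use lim in eventually_elim)
      case (elim x)
      then have "(\<lambda>j. ennreal ((cmod (u n x - u (r j) x))\<^sup>2)) \<longlonglongrightarrow> ennreal ((cmod (u n x - g x))\<^sup>2)"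
        by (intro tendsto_intros)
      then show ?case
        by (intro lim_imp_Liminf[symmetric]) auto
    qed
    also have "\<dots> \<le> liminf (\<lambda>j. \<integral>\<^sup>+x. ennreal ((cmod (u n x - u (r j) x))\<^sup>2) \<partial>lebesgue)"
      by (rule nn_integral_liminf) measurable
    also have "\<dots> \<le> ennreal (((1/8) ^ k)\<^sup>2)"
    proof (rule Liminf_le, simp)
      have "(\<integral>\<^sup>+x. ennreal ((cmod (u n x - u (r j) x))\<^sup>2) \<partial>lebesgue) \<le> ennreal (((1/8) ^ k)\<^sup>2)"
        if "j \<ge> k" for j
      proof -
        have "L2_norm (\<lambda>x. u n x - u (r j) x) < (1/8) ^ k" using n rN[OF that] by (rule N)
        then have "(L2_norm (\<lambda>x. u n x - u (r j) x))\<^sup>2 \<le> ((1/8) ^ k)\<^sup>2" by (intro power_mono) auto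
        then show ?thesis by (simp add: L2_nn_integral[OF L2_diff[OF u u]] ennreal_leI)
      qed
      then show "\<forall>\<^sub>F j in sequentially. (\<integral>\<^sup>+x. ennreal ((cmod (u n x - u (r j) x))\<^sup>2) \<partial>lebesgue) \<le> ennreal (((1/8) ^ k)\<^sup>2)"
        by (auto simp: eventually_sequentially)
    qed
    finally show ?thesis
      by (intro conjI L2_nn_integral_bound) auto
  qed
  have "g \<in> L2"
    using L2_diff[OF u[of "N 0"], of "\<lambda>x. u (N 0) x - g x"] close[of 0 "N 0"] by simp
  moreover have "(\<lambda>n. L2_norm (\<lambda>x. u n x - g x)) \<longlonglongrightarrow> 0"
  proof (rule LIMSEQ_I)
    fix e :: real assume "e > 0"
    then obtain k where "(1/8::real) ^ k < e"
      using real_arch_pow_inv[of e "1/8"] by auto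
    then show "\<exists>n0. \<forall>n\<ge>n0. norm (L2_norm (\<lambda>x. u n x - g x) - 0) < e"
      using close by (intro exI[of _ "N k"]) (force intro: le_less_trans)
  qed
  ultimately show ?thesis by (rule that)
qed

section \<open>Continuity of translations\<close>

lemma integrable_translate:
  fixes f :: "real \<Rightarrow> 'a :: {banach, second_countable_topology}"
  shows "integrable lborel f \<Longrightarrow> integrable lborel (\<lambda>x. f (t + x))"
  using lborel_integrable_real_affine[of f 1 t] by simp

lemma integral_translate:
  fixes f :: "real \<Rightarrow> 'a :: {banach, second_countable_topology}"
  shows "(LINT x|lborel. f (t + x)) = (LINT x|lborel. f x)"
  using lborel_integral_real_affine[of 1 f t] by simp

text \<open>A three-epsilon argument: by translation invariance the shifted error of the approximant
  \<open>g\<close> has the same integral as the unshifted one, so a single approximation controls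
  both outer terms.\<close>

lemma L1_translation_approx:
  fixes f :: "real \<Rightarrow> 'a :: {banach, second_countable_topology}"
  assumes f: "integrable lborel f"
    and approx: "\<And>e. e > 0 \<Longrightarrow> \<exists>g. integrable lborel g \<and> (LINT x|lborel. norm (f x - g x)) < e \<and>
        (\<lambda>n. LINT x|lborel. norm (g (t n + x) - g x)) \<longlonglongrightarrow> 0"
  shows "(\<lambda>n. LINT x|lborel. norm (f (t n + x) - f x)) \<longlonglongrightarrow> 0"
proof (rule LIMSEQ_I)
  fix e :: real assume "e > 0"
  then obtain g where g: "integrable lborel g" "(LINT x|lborel. norm (f x - g x)) < e / 3"
    and gt: "(\<lambda>n. LINT x|lborel. norm (g (t n + x) - g x)) \<longlonglongrightarrow> 0"
    using approx[of "e / 3"] by auto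
  obtain N where N: "\<And>n. n \<ge> N \<Longrightarrow> norm (LINT x|lborel. norm (g (t n + x) - g x)) < e / 3"
    using LIMSEQ_D[OF gt, of "e / 3"] \<open>e > 0\<close> by auto
  have "norm ((LINT x|lborel. norm (f (t n + x) - f x)) - 0) < e" if "n \<ge> N" for n
  proof -
    note i = integrable_translate[OF f, of "t n"] integrable_translate[OF g(1), of "t n"] f g(1)
    have "(LINT x|lborel. norm (f (t n + x) - f x))
        \<le> (LINT x|lborel. norm (f (t n + x) - g (t n + x)) + norm (g (t n + x) - g x) + norm (f x - g x))"
    proof (rule integral_mono)
      fix x
      have eq: "f (t n + x) - f x = (f (t n + x) - g (t n + x)) + (g (t n + x) - g x) - (f x - g x)"
        by simp
      show "norm (f (t n + x) - f x)
          \<le> norm (f (t n + x) - g (t n + x)) + norm (g (t n + x) - g x) + norm (f x - g x)"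
        unfolding eq
        using norm_triangle_ineq4[of "(f (t n + x) - g (t n + x)) + (g (t n + x) - g x)" "f x - g x"]
          norm_triangle_ineq[of "f (t n + x) - g (t n + x)" "g (t n + x) - g x"] by linarith
    qed (intro Bochner_Integration.integrable_add integrable_norm Bochner_Integration.integrable_diff i)+
    also have "\<dots> = (LINT x|lborel. norm (f (t n + x) - g (t n + x)))
        + (LINT x|lborel. norm (g (t n + x) - g x)) + (LINT x|lborel. norm (f x - g x))"
      using i by simp
    also have "(LINT x|lborel. norm (f (t n + x) - g (t n + x))) = (LINT x|lborel. norm (f x - g x))"
      by (rule integral_translate)
    finally show ?thesis using g(2) N[OF that] by simp
  qed
  then show "\<exists>N. \<forall>n\<ge>N. norm ((LINT x|lborel. norm (f (t n + x) - f x)) - 0) < e" by blast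
qed

text \<open>A translation preserves the integral, so the \<open>L\<^sup>1\<close> distance is twice the integral of
  the positive part of \<open>1\<^sub>U(x) - 1\<^sub>U(t + x)\<close>, which tends to 0 pointwise because \<open>U\<close> is open.\<close>

lemma open_translation_L1:
  fixes U :: "real set"
  assumes U: "open U" "emeasure lborel U < \<infinity>" and t: "t \<longlonglongrightarrow> 0"
  shows "(\<lambda>n. LINT x|lborel. norm (indicator U (t n + x) - indicator U x :: real)) \<longlonglongrightarrow> 0"
proof -
  let ?I = "indicator U :: real \<Rightarrow> real"
  have i: "integrable lborel ?I" using U by (intro integrable_real_indicator) auto
  note it = integrable_translate[OF i]
  have [measurable]: "U \<in> sets borel" using U by auto
  have "(\<lambda>n. LINT x|lborel. max (?I x - ?I (t n + x)) 0) \<longlonglongrightarrow> (LINT x::real|lborel. (0::real))"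
  proof (rule integral_dominated_convergence[where w = ?I])
    show "AE x in lborel. (\<lambda>n. max (?I x - ?I (t n + x)) 0) \<longlonglongrightarrow> 0"
    proof (rule AE_I2)
      fix x
      show "(\<lambda>n. max (?I x - ?I (t n + x)) 0) \<longlonglongrightarrow> 0"
      proof (cases "x \<in> U")
        case True
        have "(\<lambda>n. t n + x) \<longlonglongrightarrow> 0 + x" using t by (intro tendsto_intros)
        then have "\<forall>\<^sub>F n in sequentially. t n + x \<in> U"
          using U(1) True by (auto dest: topological_tendstoD)
        then have "\<forall>\<^sub>F n in sequentially. max (?I x - ?I (t n + x)) 0 = 0"
          by eventually_elim simp
        then show ?thesis by (rule tendsto_eventually)
      qed simp
    qed
  qed (use i in \<open>auto simp: indicator_def\<close>)
  moreover have "(LINT x|lborel. norm (?I (t n + x) - ?I x)) = 2 * (LINT x|lborel. max (?I x - ?I (t n + x)) 0)" for n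
  proof -
    have "(LINT x|lborel. norm (?I (t n + x) - ?I x))
        = (LINT x|lborel. 2 * max (?I x - ?I (t n + x)) 0 + (?I (t n + x) - ?I x))"
      by (rule Bochner_Integration.integral_cong) (auto simp: indicator_def)
    also have "\<dots> = 2 * (LINT x|lborel. max (?I x - ?I (t n + x)) 0) + ((LINT x|lborel. ?I (t n + x)) - (LINT x|lborel. ?I x))"
      using i it[of "t n"]
      by (subst Bochner_Integration.integral_add) (auto intro!: integrable_max)
    finally show ?thesis by (simp only: integral_translate)
  qed
  ultimately show ?thesis using tendsto_mult_right_zero by fastforce
qed

text \<open>Induction over integrable functions. Outer regularity replaces a Borel set of finite
  measure by an open set, sums follow from the triangle inequality, and limits from dominated
  convergence and the approximation lemma.\<close>

lemma L1_translation_continuous: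
  fixes f :: "real \<Rightarrow> 'a :: {banach, second_countable_topology}"
  assumes "integrable lborel f" and t: "t \<longlonglongrightarrow> 0"
  shows "(\<lambda>n. LINT x|lborel. norm (f (t n + x) - f x)) \<longlonglongrightarrow> 0"
  using assms(1)
proof (induction rule: integrable_induct)
  case (base A c)
  have i: "integrable lborel (\<lambda>x. indicator A x *\<^sub>R c)" using base by simp
  show ?case
  proof (rule L1_translation_approx[OF i])
    fix e :: real assume e: "e > 0"
    \<comment> \<open>The \<open>+ 1\<close> covers \<open>c = 0\<close> and makes the final
      estimate \<open>norm c * e' < e\<close> strict.\<close>
    define e' where "e' = e / (norm c + 1)"
    have "e' > 0" using e by (simp add: e'_def add_nonneg_pos)
    then obtain U where U: "open U" "A \<subseteq> U" "emeasure lborel (U - A) < e'"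
      using outer_regular_lborel[of A e'] base by auto
    have [measurable]: "U \<in> sets borel" "A \<in> sets borel" using U base by auto
    have "emeasure lborel U = emeasure lborel A + emeasure lborel (U - A)"
      using U base by (subst plus_emeasure) (auto intro!: arg_cong[where f = "emeasure lborel"])
    then have fin: "emeasure lborel U < \<infinity>"
      using U base by (auto simp: top_unique less_top[symmetric])
    have iU: "integrable lborel (\<lambda>x. indicator U x *\<^sub>R c)" using fin by simp
    have "(LINT x|lborel. norm (indicator A x *\<^sub>R c - indicator U x *\<^sub>R c)) = (LINT x|lborel. norm c * indicator (U - A) x)"
      using U(2) by (intro Bochner_Integration.integral_cong) (auto simp: indicator_def)
    also have "\<dots> = norm c * measure lborel (U - A)" by simp
    also have "\<dots> \<le> norm c * e'"
      using U(3) \<open>e' > 0\<close> by (intro mult_left_mono) (auto simp: measure_def intro!: enn2real_leI)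
    also have "\<dots> < (norm c + 1) * e'" using \<open>e' > 0\<close> by simp
    also have "\<dots> = e"
      using norm_ge_zero[of c] by (simp add: e'_def add_nonneg_eq_0_iff)
    finally have close: "(LINT x|lborel. norm (indicator A x *\<^sub>R c - indicator U x *\<^sub>R c)) < e" .
    have "norm (indicator U (t n + x) *\<^sub>R c - indicator U x *\<^sub>R c)
        = norm c * norm (indicator U (t n + x) - indicator U x :: real)" for n x
      by (simp flip: scaleR_diff_left)
    then have "(\<lambda>n. LINT x|lborel. norm (indicator U (t n + x) *\<^sub>R c - indicator U x *\<^sub>R c)) \<longlonglongrightarrow> 0"
      using tendsto_mult_right_zero[OF open_translation_L1[OF U(1) fin t], of "norm c"] by simp
    then show "\<exists>g. integrable lborel g \<and> (LINT x|lborel. norm (indicator A x *\<^sub>R c - g x)) < e \<and>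
        (\<lambda>n. LINT x|lborel. norm (g (t n + x) - g x)) \<longlonglongrightarrow> 0"
      using iU close by (intro exI[of _ "\<lambda>x. indicator U x *\<^sub>R c"]) auto
  qed
next
  case (add f g)
  note i = integrable_translate[OF add(1)] integrable_translate[OF add(2)] add(1,2)
  have "(LINT x|lborel. norm (f (t n + x) + g (t n + x) - (f x + g x)))
      \<le> (LINT x|lborel. norm (f (t n + x) - f x)) + (LINT x|lborel. norm (g (t n + x) - g x))" for n
  proof -
    have "(LINT x|lborel. norm (f (t n + x) + g (t n + x) - (f x + g x)))
        \<le> (LINT x|lborel. norm (f (t n + x) - f x) + norm (g (t n + x) - g x))"
      using i by (intro integral_mono norm_diff_triangle_ineq) auto
    then show ?thesis using i by simp
  qed
  then show ?case
    by (intro Lim_null_comparison[OF _ tendsto_add_zero[OF add(3,4)]] always_eventually allI) auto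
next
  case (lim f s)
  show ?case
  proof (rule L1_translation_approx[OF lim(4)])
    fix e :: real assume e: "e > 0"
    have "(\<lambda>i. LINT x|lborel. norm (f x - s i x)) \<longlonglongrightarrow> (LINT x::real|lborel. (0::real))"
    \<comment> \<open>The approximants of the induction satisfy
      \<open>norm (s i x) \<le> 2 * norm (f x)\<close>, whence the factor 3.\<close>
    proof (rule integral_dominated_convergence[where w = "\<lambda>x. 3 * norm (f x)"])
      show "AE x in lborel. (\<lambda>i. norm (f x - s i x)) \<longlonglongrightarrow> 0"
      proof (rule AE_I2)
        fix x
        have "(\<lambda>i. norm (f x - s i x)) \<longlonglongrightarrow> norm (f x - f x)"
          using lim(2)[of x] by (intro tendsto_intros) auto
        then show "(\<lambda>i. norm (f x - s i x)) \<longlonglongrightarrow> 0" by simp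
      qed
      show "AE x in lborel. norm (norm (f x - s i x)) \<le> 3 * norm (f x)" for i
      proof (rule AE_I2)
        fix x
        show "norm (norm (f x - s i x)) \<le> 3 * norm (f x)"
          using norm_triangle_ineq4[of "f x" "s i x"] lim(3)[of x i] by simp
      qed
    qed (use lim(1,4) in auto)
    then obtain i where "norm ((LINT x|lborel. norm (f x - s i x)) - 0) < e"
      using LIMSEQ_D[of _ "0::real" e] e by fastforce
    then show "\<exists>g. integrable lborel g \<and> (LINT x|lborel. norm (f x - g x)) < e \<and>
        (\<lambda>n. LINT x|lborel. norm (g (t n + x) - g x)) \<longlonglongrightarrow> 0"
      using lim(1,5) by (intro exI[of _ "s i"]) auto
  qed
qed

text \<open>This reduces translation continuity in \<open>L\<^sup>2\<close> to translation continuity in \<open>L\<^sup>1\<close>.\<close>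

lemma norm_diff_power2_le:
  fixes a b :: "'a :: real_inner"
  shows "(norm (a - b))\<^sup>2 \<le> 2 * norm (norm a *\<^sub>R a - norm b *\<^sub>R b)"
proof (cases "a = b")
  case False
  let ?d = "norm a *\<^sub>R a - norm b *\<^sub>R b"
  \<comment> \<open>The map \<open>a \<mapsto> |a| a\<close> is strongly monotone: its increment
    paired with \<open>a - b\<close> is at least \<open>(|a| + |b|) |a - b|^2 / 2\<close>, hence at
    least \<open>|a - b|^3 / 2\<close>. Cauchy-Schwarz then allows one factor \<open>|a - b|\<close>
    to be cancelled.\<close>
  have "?d \<bullet> (a - b) = (norm a + norm b) * ((norm a)\<^sup>2 - norm a * norm b + (norm b)\<^sup>2 - a \<bullet> b)"
    by (simp add: inner_diff_left inner_diff_right dot_square_norm inner_commute[of b a]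
        algebra_simps power2_eq_square)
  moreover have "(norm (a - b))\<^sup>2 / 2 \<le> (norm a)\<^sup>2 - norm a * norm b + (norm b)\<^sup>2 - a \<bullet> b"
    using zero_le_power2[of "norm a - norm b"] dot_norm_neg[of a b] by (simp add: power2_diff field_simps)
  ultimately have "(norm a + norm b) * ((norm (a - b))\<^sup>2 / 2) \<le> ?d \<bullet> (a - b)"
    by (metis add_nonneg_nonneg mult_left_mono norm_ge_zero)
  then have "norm (a - b) * ((norm (a - b))\<^sup>2 / 2) \<le> ?d \<bullet> (a - b)"
    using mult_right_mono[OF norm_triangle_ineq4[of a b], of "(norm (a - b))\<^sup>2 / 2"] by simp
  also have "\<dots> \<le> norm (a - b) * norm ?d"
    using norm_cauchy_schwarz[of ?d "a - b"] by (simp add: mult.commute)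
  finally show ?thesis using False by simp
qed simp

lemma L2_translation_continuous:
  fixes u :: "real \<Rightarrow> complex"
  assumes [measurable]: "u \<in> borel_measurable borel" and u: "integrable lborel (\<lambda>x. (cmod (u x))\<^sup>2)"
    and t: "t \<longlonglongrightarrow> 0"
  shows "integrable lborel (\<lambda>x. (cmod (u (t n + x) - u x))\<^sup>2)"
    and "(\<lambda>n. LINT x|lborel. (cmod (u (t n + x) - u x))\<^sup>2) \<longlonglongrightarrow> 0"
proof -
  \<comment> \<open>Since \<open>|?v| = |u|^2\<close>, the function \<open>?v\<close> is integrable,
    and twice the \<open>L^1\<close> distance between \<open>?v\<close> and its translate dominates
    the squared \<open>L^2\<close> distance for \<open>u\<close>.\<close>
  let ?v = "\<lambda>x. cmod (u x) *\<^sub>R u x"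
  have v: "integrable lborel ?v"
    by (rule Bochner_Integration.integrable_bound[OF u]) (auto simp: power2_eq_square norm_mult)
  note i = v integrable_translate[OF v]
  have le: "(cmod (u (t n + x) - u x))\<^sup>2 \<le> 2 * cmod (?v (t n + x) - ?v x)" for n x
    by (rule norm_diff_power2_le)
  have iv: "integrable lborel (\<lambda>x. 2 * cmod (?v (t n + x) - ?v x))" for n
    using i by (intro integrable_mult_right integrable_norm Bochner_Integration.integrable_diff)
  show iu: "integrable lborel (\<lambda>x. (cmod (u (t n + x) - u x))\<^sup>2)" for n
    by (rule Bochner_Integration.integrable_bound[OF iv]) (use le in auto)
  have "(LINT x|lborel. (cmod (u (t n + x) - u x))\<^sup>2) \<le> 2 * (LINT x|lborel. cmod (?v (t n + x) - ?v x))" for n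
    using integral_mono[OF iu iv le] by simp
  then show "(\<lambda>n. LINT x|lborel. (cmod (u (t n + x) - u x))\<^sup>2) \<longlonglongrightarrow> 0"
    by (intro Lim_null_comparison[OF _ tendsto_mult_right_zero[OF L1_translation_continuous[OF v t]]]
        always_eventually allI) auto
qed

section \<open>Plancherel's theorem\<close>

text \<open>Unnormalized and over \<open>lborel\<close>, which suits Fubini;
  \<open>fourier_L1_eq_fourier\<close> restores the factor \<open>1 / sqrt (2 * pi)\<close>.\<close>

definition fourier :: "(real \<Rightarrow> complex) \<Rightarrow> real \<Rightarrow> complex" where
  "fourier u w = (LINT x|lborel. u x * exp (- \<i> * complex_of_real w * complex_of_real x))"

lemma norm_exp_fourier [simp]: "cmod (exp (- (\<i> * complex_of_real w * complex_of_real x))) = 1"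
  "cmod (exp (\<i> * complex_of_real w * complex_of_real x)) = 1"
  by (simp_all add: norm_exp_eq_Re)

lemma integrable_mult_bounded:
  fixes u h :: "'a \<Rightarrow> complex"
  assumes u: "integrable M u" and [measurable]: "h \<in> borel_measurable M" and h: "\<And>x. cmod (h x) \<le> K"
  shows "integrable M (\<lambda>x. u x * h x)" and "integrable M (\<lambda>x. h x * u x)"
proof -
  have [measurable]: "u \<in> borel_measurable M" using u by auto
  have "integrable M (\<lambda>x. of_real K * u x)" using u by simp
  then show *: "integrable M (\<lambda>x. u x * h x)"
  proof (rule Bochner_Integration.integrable_bound)
    show "(\<lambda>x. u x * h x) \<in> borel_measurable M" by measurable
    show "AE x in M. cmod (u x * h x) \<le> cmod (of_real K * u x)"
      using h order_trans[OF norm_ge_zero h]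
      by (auto simp: norm_mult mult.commute intro!: mult_right_mono)
  qed
  show "integrable M (\<lambda>x. h x * u x)"
    using * by (simp add: mult.commute)
qed

lemma fourier_measurable [measurable]:
  assumes [measurable]: "u \<in> borel_measurable borel"
  shows "fourier u \<in> borel_measurable borel"
  unfolding fourier_def by measurable

lemma integrable_fourier_kernel:
  assumes "integrable lborel u"
  shows "integrable lborel (\<lambda>x. u x * exp (- (\<i> * complex_of_real w * complex_of_real x)))"
  by (rule integrable_mult_bounded(1)[OF assms, where K = 1]) auto

lemma norm_fourier_le:
  assumes "integrable lborel u"
  shows "cmod (fourier u w) \<le> (LINT x|lborel. cmod (u x))"
  unfolding fourier_def
  using integral_norm_bound[of lborel "\<lambda>x. u x * exp (- \<i> * complex_of_real w * complex_of_real x)"]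
  by (simp add: norm_mult)

text \<open>Both sides are iterated integrals of one kernel of modulus \<open>|u x| |h w|\<close>,
  which is integrable on the product, so Fubini applies.\<close>

lemma fourier_multiplication:
  assumes u: "integrable lborel u" and h: "integrable lborel h"
  shows "(LINT w|lborel. fourier u w * h w) = (LINT x|lborel. u x * fourier h x)"
proof -
  have [measurable]: "u \<in> borel_measurable borel" "h \<in> borel_measurable borel" using u h by auto
  define k where "k x w = u x * h w * exp (- \<i> * complex_of_real w * complex_of_real x)" for x w
  have nk: "cmod (k x w) = cmod (u x) * cmod (h w)" for x w
    by (simp add: k_def norm_mult)
  have [measurable]: "case_prod k \<in> borel_measurable (borel \<Otimes>\<^sub>M borel)"
    unfolding k_def by measurable
  have ik: "integrable (lborel \<Otimes>\<^sub>M lborel) (case_prod k)"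
  proof (rule lborel_pair.Fubini_integrable)
    show "integrable lborel (\<lambda>x. LINT w|lborel. cmod (case_prod k (x, w)))"
      using u by (simp add: nk)
    show "AE x in lborel. integrable lborel (\<lambda>w. case_prod k (x, w))"
    proof (rule AE_I2)
      fix x
      have "integrable lborel (\<lambda>w. u x * (h w * exp (- (\<i> * complex_of_real x * complex_of_real w))))"
        by (intro integrable_mult_right integrable_fourier_kernel h)
      then show "integrable lborel (\<lambda>w. case_prod k (x, w))" by (simp add: k_def mult_ac)
    qed
  qed measurable
  have "(LINT w|lborel. fourier u w * h w) = (LINT w|lborel. LINT x|lborel. k x w)"
    unfolding fourier_def k_def
    by (simp add: mult_ac flip: integral_mult_left_zero)
  also have "\<dots> = (LINT x|lborel. LINT w|lborel. k x w)"
    by (rule lborel_pair.Fubini_integral[OF ik])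
  also have "\<dots> = (LINT x|lborel. u x * fourier h x)"
    unfolding fourier_def k_def
    by (simp add: mult_ac flip: integral_mult_right_zero)
  finally show ?thesis .
qed

text \<open>The substitution \<open>z = \<sigma> w\<close> turns the integral into the
  characteristic function of the standard normal distribution at
  \<open>- t / \<sigma>\<close>.\<close>

lemma fourier_gaussian:
  assumes \<sigma>: "\<sigma> > 0"
  shows "fourier (\<lambda>w. of_real (exp (- (\<sigma> * w)\<^sup>2 / 2))) t = of_real (2 * pi * normal_density 0 \<sigma> t)"
proof -
  define f where "f z = of_real (sqrt (2 * pi) * std_normal_density z) * iexp ((- t / \<sigma>) * z)" for z :: real
  have "fourier (\<lambda>w. of_real (exp (- (\<sigma> * w)\<^sup>2 / 2))) t = (LINT w|lborel. f (0 + \<sigma> * w))"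
    unfolding fourier_def f_def using \<sigma>
    by (intro Bochner_Integration.integral_cong) (auto simp: std_normal_density_def field_simps)
  also have "\<dots> = of_real (1 / \<sigma>) * (LINT z|lborel. f z)"
    using \<sigma> lborel_integral_real_affine[of \<sigma> f 0] by (simp add: scaleR_conv_of_real)
  also have "(LINT z|lborel. f z) = of_real (sqrt (2 * pi)) * char std_normal_distribution (- t / \<sigma>)"
    unfolding char_def f_def
    by (subst integral_density) (auto simp: scaleR_conv_of_real mult_ac simp flip: integral_mult_right_zero)
  also have "\<dots> = of_real (sqrt (2 * pi) * exp (- (t / \<sigma>)\<^sup>2 / 2))"
    by (simp add: char_std_normal_distribution)
  also have "of_real (1 / \<sigma>) * \<dots> = complex_of_real (2 * pi * normal_density 0 \<sigma> t)"
    unfolding of_real_mult[symmetric] of_real_eq_iff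
    using \<sigma> by (simp add: normal_density_def real_sqrt_mult power_divide field_simps)
  finally show ?thesis .
qed

lemma integrable_gaussian:
  assumes "\<sigma> > 0" shows "integrable lborel (\<lambda>w. exp (- (\<sigma> * w)\<^sup>2 / 2) :: real)"
proof -
  have "integrable lborel (\<lambda>w. sqrt (2 * pi) * std_normal_density (0 + \<sigma> * w))"
    using assms by (intro integrable_mult_right lborel_integrable_real_affine) auto
  then show ?thesis by (simp add: std_normal_density_def)
qed

lemma borel_measurable_cnj [measurable]:
  "f \<in> borel_measurable M \<Longrightarrow> (\<lambda>x. cnj (f x)) \<in> borel_measurable M"
  by (rule borel_measurable_continuous_on[OF continuous_on_cnj[OF continuous_on_id]])

text \<open>Cauchy-Schwarz, where both factors have the same norm by translation invariance.\<close>

lemma autocorrelation: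
  fixes u :: "real \<Rightarrow> complex"
  assumes [measurable]: "u \<in> borel_measurable borel" and u: "integrable lborel (\<lambda>x. (cmod (u x))\<^sup>2)"
  shows "integrable lborel (\<lambda>x. u x * cnj (u (t + x)))"
    and "(LINT x|lborel. cmod (u x) * cmod (u (t + x))) \<le> (LINT x|lborel. (cmod (u x))\<^sup>2)"
proof -
  have ut: "integrable lborel (\<lambda>x. (cmod (u (t + x)))\<^sup>2)"
    by (rule integrable_translate[OF u])
  have ut': "(LINT x|lborel. (cmod (u (t + x)))\<^sup>2) = (LINT x|lborel. (cmod (u x))\<^sup>2)"
    by (rule integral_translate)
  have i: "integrable lborel (\<lambda>x. cmod (u x) * cmod (u (t + x)))"
    and cs: "(LINT x|lborel. cmod (u x) * cmod (u (t + x)))\<^sup>2 \<le> (LINT x|lborel. (cmod (u x))\<^sup>2)\<^sup>2"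
    using integral_Cauchy_Schwarz[of "\<lambda>x. cmod (u x)" lborel "\<lambda>x. cmod (u (t + x))"] u ut ut'
    by (auto simp: power2_eq_square)
  show "integrable lborel (\<lambda>x. u x * cnj (u (t + x)))"
    by (rule Bochner_Integration.integrable_bound[OF i]) (auto simp: norm_mult)
  show "(LINT x|lborel. cmod (u x) * cmod (u (t + x))) \<le> (LINT x|lborel. (cmod (u x))\<^sup>2)"
    using cs by (rule power2_le_imp_le) simp
qed

text \<open>At shift 0 the autocorrelation is the squared norm \<open>N\<close>. By Cauchy-Schwarz
  the deviation from it is at most \<open>sqrt (N * D n)\<close>, and \<open>D n\<close> tends to 0
  by continuity of translations.\<close>

lemma autocorrelation_tendsto:
  fixes u :: "real \<Rightarrow> complex"
  assumes [measurable]: "u \<in> borel_measurable borel" and u: "integrable lborel (\<lambda>x. (cmod (u x))\<^sup>2)"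
    and t: "t \<longlonglongrightarrow> 0"
  shows "(\<lambda>n. LINT x|lborel. u x * cnj (u (t n + x))) \<longlonglongrightarrow> of_real (LINT x|lborel. (cmod (u x))\<^sup>2)"
proof -
  define N where "N = (LINT x|lborel. (cmod (u x))\<^sup>2)"
  define D where "D n = (LINT x|lborel. (cmod (u (t n + x) - u x))\<^sup>2)" for n
  have D: "D \<longlonglongrightarrow> 0" and iD: "integrable lborel (\<lambda>x. (cmod (u (t n + x) - u x))\<^sup>2)" for n
    unfolding D_def using L2_translation_continuous[OF assms] by auto
  have i0: "integrable lborel (\<lambda>x. u x * cnj (u x))"
    using autocorrelation(1)[OF assms(1,2), of 0] by simp
  have "cmod ((LINT x|lborel. u x * cnj (u (t n + x))) - of_real N) \<le> sqrt (N * D n)" for n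
  proof -
    have "of_real N = (LINT x|lborel. u x * cnj (u x))"
      by (simp only: N_def complex_norm_square flip: integral_complex_of_real)
    then have "(LINT x|lborel. u x * cnj (u (t n + x))) - of_real N
        = (LINT x|lborel. u x * cnj (u (t n + x)) - u x * cnj (u x))"
      by (simp only: Bochner_Integration.integral_diff[OF autocorrelation(1)[OF assms(1,2)] i0])
    also have "cmod \<dots> \<le> (LINT x|lborel. cmod (u x * cnj (u (t n + x)) - u x * cnj (u x)))"
      by (rule integral_norm_bound)
    also have "\<dots> = (LINT x|lborel. cmod (u x) * cmod (u (t n + x) - u x))"
      by (intro Bochner_Integration.integral_cong refl)
        (simp only: norm_mult complex_mod_cnj right_diff_distrib[symmetric] complex_cnj_diff[symmetric])
    also have "\<dots> \<le> sqrt (N * D n)"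
      unfolding N_def D_def
      by (rule real_le_rsqrt, rule integral_Cauchy_Schwarz(2)[OF _ _ u iD]) measurable
    finally show ?thesis .
  qed
  moreover have "(\<lambda>n. sqrt (N * D n)) \<longlonglongrightarrow> sqrt (N * 0)"
    using D by (intro tendsto_intros)
  ultimately have "(\<lambda>n. (LINT x|lborel. u x * cnj (u (t n + x))) - of_real N) \<longlonglongrightarrow> 0"
    by (rule_tac Lim_null_comparison[of _ "\<lambda>n. sqrt (N * D n)"]) auto
  then show ?thesis
    unfolding N_def[symmetric] by (rule LIM_zero_cancel)
qed

text \<open>The Gaussian makes \<open>h = g * cnj (fourier u)\<close> integrable, so the
  multiplication formula applies to \<open>u\<close> and \<open>h\<close>. The transform of
  \<open>h\<close> is a Gaussian average of translates of \<open>cnj u\<close>, and Fubini brings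
  the autocorrelation inside. After rescaling, \<open>\<sigma>\<close> survives only in the shift,
  which prepares the limit \<open>\<sigma> \<rightarrow> 0\<close>.\<close>

lemma fourier_power2_gaussian:
  fixes u :: "real \<Rightarrow> complex"
  assumes u: "integrable lborel u" and u2: "integrable lborel (\<lambda>x. (cmod (u x))\<^sup>2)" and \<sigma>: "\<sigma> > 0"
  shows "integrable lborel (\<lambda>w. (cmod (fourier u w))\<^sup>2 * exp (- (\<sigma> * w)\<^sup>2 / 2))"
    and "of_real (LINT w|lborel. (cmod (fourier u w))\<^sup>2 * exp (- (\<sigma> * w)\<^sup>2 / 2))
      = 2 * pi * (LINT z|lborel. of_real (std_normal_density z) * (LINT x|lborel. u x * cnj (u (\<sigma> * z + x))))"
proof -
  have [measurable]: "u \<in> borel_measurable borel" using u by auto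
  define N where "N = (LINT x|lborel. (cmod (u x))\<^sup>2)"
  define g where "g w = complex_of_real (exp (- (\<sigma> * w)\<^sup>2 / 2))" for w
  have g: "integrable lborel g"
    unfolding g_def using integrable_gaussian[OF \<sigma>] by simp
  have [measurable]: "g \<in> borel_measurable borel" using g by auto
  define h where "h w = g w * cnj (fourier u w)" for w
  have h: "integrable lborel h"
    unfolding h_def using norm_fourier_le[OF u] by (intro integrable_mult_bounded(1)[OF g]) auto
  have [measurable]: "h \<in> borel_measurable borel" using h by auto
  have "integrable lborel (\<lambda>w. h w * fourier u w)"
    using norm_fourier_le[OF u] by (intro integrable_mult_bounded(1)[OF h]) auto
  moreover have hF: "h w * fourier u w = of_real ((cmod (fourier u w))\<^sup>2 * exp (- (\<sigma> * w)\<^sup>2 / 2))" for w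
    by (simp only: h_def g_def of_real_mult complex_norm_square mult_ac)
  ultimately show "integrable lborel (\<lambda>w. (cmod (fourier u w))\<^sup>2 * exp (- (\<sigma> * w)\<^sup>2 / 2))"
    by (simp only: complex_of_real_integrable_eq)
  \<comment> \<open>After conjugation the multiplication formula is used again, with the modulated
    Gaussian \<open>e\<close>. Its transform is a multiple of the normal density centred at
    \<open>x\<close>, and \<open>y = x + \<sigma> z\<close> reduces this to the standard
    density.\<close>
  have Fh: "fourier h x = 2 * pi * (LINT z|lborel. of_real (std_normal_density z) * cnj (u (\<sigma> * z + x)))" for x
  proof -
    define e where "e w = g w * exp (\<i> * complex_of_real w * complex_of_real x)" for w
    have e: "integrable lborel e"
      unfolding e_def by (rule integrable_mult_bounded(1)[OF g, where K = 1]) auto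
    have Fe: "fourier e y = of_real (2 * pi * normal_density 0 \<sigma> (y - x))" for y
    proof -
      have "fourier e y = fourier g (y - x)"
        unfolding fourier_def e_def
        by (intro Bochner_Integration.integral_cong) (auto simp: algebra_simps simp flip: exp_add)
      then show ?thesis
        unfolding g_def by (simp only: fourier_gaussian[OF \<sigma>])
    qed
    have "cnj (fourier h x) = (LINT w|lborel. cnj (h w * exp (- \<i> * complex_of_real x * complex_of_real w)))"
      by (simp only: fourier_def Bochner_Integration.integral_cnj)
    also have "\<dots> = (LINT w|lborel. fourier u w * e w)"
      by (intro Bochner_Integration.integral_cong) (auto simp: h_def e_def g_def mult_ac exp_cnj)
    also have "\<dots> = (LINT y|lborel. u y * fourier e y)"
      by (rule fourier_multiplication[OF u e])
    also have "\<dots> = of_real \<sigma> * (LINT z|lborel. u (x + \<sigma> * z) * fourier e (x + \<sigma> * z))"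
      using lborel_integral_real_affine[of \<sigma> "\<lambda>y. u y * fourier e y" x] \<sigma> by (simp add: scaleR_conv_of_real)
    also have "\<dots> = (LINT z|lborel. 2 * pi * (of_real (std_normal_density z) * u (\<sigma> * z + x)))"
      unfolding integral_mult_right_zero[symmetric] Fe
    proof (intro Bochner_Integration.integral_cong refl)
      fix z
      have "\<sigma> * normal_density 0 \<sigma> (\<sigma> * z) = std_normal_density z"
        using \<sigma> by (simp add: normal_density_def real_sqrt_mult power_mult_distrib)
      then have "complex_of_real \<sigma> * complex_of_real (normal_density 0 \<sigma> (\<sigma> * z)) = complex_of_real (std_normal_density z)"
        by (metis of_real_mult)
      then show "complex_of_real \<sigma> * (u (x + \<sigma> * z) * of_real (2 * pi * normal_density 0 \<sigma> (x + \<sigma> * z - x)))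
          = 2 * pi * (of_real (std_normal_density z) * u (\<sigma> * z + x))"
        by (simp add: add.commute)
    qed
    also have "\<dots> = 2 * pi * (LINT z|lborel. of_real (std_normal_density z) * u (\<sigma> * z + x))"
      by simp
    finally have "fourier h x = cnj (2 * pi * (LINT z|lborel. of_real (std_normal_density z) * u (\<sigma> * z + x)))"
      by (metis complex_cnj_cnj)
    then show ?thesis
      by (simp del: Bochner_Integration.integral_cnj add: Bochner_Integration.integral_cnj[symmetric])
  qed
  define k where "k z x = of_real (std_normal_density z) * (u x * cnj (u (\<sigma> * z + x)))" for z x
  have [measurable]: "case_prod k \<in> borel_measurable (borel \<Otimes>\<^sub>M borel)"
    unfolding k_def by measurable
  have nk: "cmod (k z x) = std_normal_density z * (cmod (u x) * cmod (u (\<sigma> * z + x)))" for z x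
    by (simp add: k_def norm_mult)
  have ik: "integrable (lborel \<Otimes>\<^sub>M lborel) (case_prod k)"
  proof (rule lborel_pair.Fubini_integrable)
    show "integrable lborel (\<lambda>z. LINT x|lborel. cmod (case_prod k (z, x)))"
    proof (rule Bochner_Integration.integrable_bound)
      show "integrable lborel (\<lambda>z. std_normal_density z * N)" by simp
      show "AE z in lborel. norm (LINT x|lborel. cmod (case_prod k (z, x))) \<le> norm (std_normal_density z * N)"
        using autocorrelation(2)[OF _ u2]
        by (auto simp: nk N_def abs_mult intro!: mult_left_mono)
    qed measurable
    show "AE z in lborel. integrable lborel (\<lambda>x. case_prod k (z, x))"
      using autocorrelation(1)[OF _ u2] by (auto simp: k_def)
  qed measurable
  have "of_real (LINT w|lborel. (cmod (fourier u w))\<^sup>2 * exp (- (\<sigma> * w)\<^sup>2 / 2)) = (LINT w|lborel. fourier u w * h w)"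
    by (simp only: mult.commute[of "fourier u _" "h _"] hF integral_complex_of_real)
  also have "\<dots> = (LINT x|lborel. u x * fourier h x)"
    by (rule fourier_multiplication[OF u h])
  also have "\<dots> = 2 * pi * (LINT x|lborel. LINT z|lborel. k z x)"
    unfolding Fh k_def integral_mult_right_zero[symmetric] by (simp add: mult_ac)
  also have "(LINT x|lborel. LINT z|lborel. k z x) = (LINT z|lborel. LINT x|lborel. k z x)"
    by (rule lborel_pair.Fubini_integral[OF ik])
  finally show "of_real (LINT w|lborel. (cmod (fourier u w))\<^sup>2 * exp (- (\<sigma> * w)\<^sup>2 / 2))
      = 2 * pi * (LINT z|lborel. of_real (std_normal_density z) * (LINT x|lborel. u x * cnj (u (\<sigma> * z + x))))"
    by (simp only: k_def integral_mult_right_zero)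
qed

text \<open>Let the Gaussian width parameter \<open>s n\<close> decrease to 0. The autocorrelation
  side converges by domination with \<open>N\<close> times the normal density. On the Fourier side
  the integrands increase to \<open>|fourier u|^2\<close>, so monotone convergence yields
  integrability together with the value.\<close>

theorem plancherel_borel:
  fixes u :: "real \<Rightarrow> complex"
  assumes u: "integrable lborel u" and u2: "integrable lborel (\<lambda>x. (cmod (u x))\<^sup>2)"
  shows "integrable lborel (\<lambda>w. (cmod (fourier u w))\<^sup>2)"
    and "(LINT w|lborel. (cmod (fourier u w))\<^sup>2) = 2 * pi * (LINT x|lborel. (cmod (u x))\<^sup>2)"
proof -
  have [measurable]: "u \<in> borel_measurable borel" using u by auto
  define N where "N = (LINT x|lborel. (cmod (u x))\<^sup>2)"
  define s where "s n = inverse (real (Suc n))" for n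
  have s: "s n > 0" for n by (simp add: s_def)
  have s0: "s \<longlonglongrightarrow> 0" unfolding s_def by (rule LIMSEQ_inverse_real_of_nat)
  define G where "G n w = (cmod (fourier u w))\<^sup>2 * exp (- (s n * w)\<^sup>2 / 2)" for n w
  define C where "C n z = (LINT x|lborel. u x * cnj (u (s n * z + x)))" for n z
  have C_le: "cmod (C n z) \<le> N" for n z
  proof -
    have "cmod (C n z) \<le> (LINT x|lborel. cmod (u x * cnj (u (s n * z + x))))"
      unfolding C_def by (rule integral_norm_bound)
    then show ?thesis
      using autocorrelation(2)[OF _ u2, of "s n * z"] by (simp add: norm_mult N_def)
  qed
  have lim: "(\<lambda>n. LINT z|lborel. of_real (std_normal_density z) * C n z)
      \<longlonglongrightarrow> (LINT z|lborel. of_real (std_normal_density z) * of_real N)"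
  proof (rule integral_dominated_convergence[where w = "\<lambda>z. std_normal_density z * N"])
    show "AE z in lborel. (\<lambda>n. of_real (std_normal_density z) * C n z) \<longlonglongrightarrow> of_real (std_normal_density z) * complex_of_real N"
    proof (intro AE_I2 tendsto_mult_left)
      fix z
      show "(\<lambda>n. C n z) \<longlonglongrightarrow> complex_of_real N"
        unfolding C_def N_def
        by (rule autocorrelation_tendsto[OF _ u2]) (use tendsto_mult_left_zero[OF s0] in auto)
    qed
    show "AE z in lborel. cmod (of_real (std_normal_density z) * C n z) \<le> std_normal_density z * N" for n
      using C_le by (auto simp: norm_mult intro!: mult_left_mono)
    show "(\<lambda>z. of_real (std_normal_density z) * C n z) \<in> borel_measurable lborel" for n
      unfolding C_def by measurable
  qed auto
  have "(LINT z|lborel. complex_of_real (std_normal_density z) * of_real N) = of_real N"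
    by (simp flip: of_real_mult)
  with lim have "(\<lambda>n. 2 * pi * (LINT z|lborel. of_real (std_normal_density z) * C n z)) \<longlonglongrightarrow> 2 * pi * complex_of_real N"
    by (intro tendsto_mult_left) simp
  then have "(\<lambda>n. of_real (LINT w|lborel. G n w)) \<longlonglongrightarrow> complex_of_real (2 * pi * N)"
    by (simp only: G_def C_def fourier_power2_gaussian(2)[OF u u2 s] of_real_mult of_real_numeral)
  then have iG: "(\<lambda>n. LINT w|lborel. G n w) \<longlonglongrightarrow> 2 * pi * N"
    by (simp only: tendsto_of_real_iff)
  have G: "integrable lborel (G n)" for n
    unfolding G_def by (rule fourier_power2_gaussian(1)[OF u u2 s])
  have mono: "AE w in lborel. mono (\<lambda>n. G n w)"
  proof (intro AE_I2 monoI)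
    fix w and m n :: nat assume "m \<le> n"
    then have "s n \<le> s m" by (simp add: s_def)
    then have "(s n * w)\<^sup>2 \<le> (s m * w)\<^sup>2"
      using s[of n] unfolding power_mult_distrib by (intro mult_right_mono power_mono) auto
    then show "G m w \<le> G n w"
      unfolding G_def by (intro mult_left_mono) auto
  qed
  have limG: "AE w in lborel. (\<lambda>n. G n w) \<longlonglongrightarrow> (cmod (fourier u w))\<^sup>2"
  proof (rule AE_I2)
    fix w
    have "(\<lambda>n. G n w) \<longlonglongrightarrow> (cmod (fourier u w))\<^sup>2 * exp (- (0 * w)\<^sup>2 / 2)"
      unfolding G_def by (intro tendsto_intros s0) auto
    then show "(\<lambda>n. G n w) \<longlonglongrightarrow> (cmod (fourier u w))\<^sup>2" by simp
  qed
  have m: "(\<lambda>w. (cmod (fourier u w))\<^sup>2) \<in> borel_measurable lborel" by measurable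
  show "integrable lborel (\<lambda>w. (cmod (fourier u w))\<^sup>2)"
    "(LINT w|lborel. (cmod (fourier u w))\<^sup>2) = 2 * pi * (LINT x|lborel. (cmod (u x))\<^sup>2)"
    using integrable_monotone_convergence[OF G mono limG iG m]
      integral_monotone_convergence[OF G mono limG iG m] by (simp_all add: N_def)
qed

section \<open>Plancherel's theorem for Lebesgue measurable functions\<close>

lemma fourier_L1_cong_AE:
  assumes "AE x in lebesgue. u x = v x" and [measurable]: "u \<in> borel_measurable lebesgue" "v \<in> borel_measurable lebesgue"
  shows "fourier_L1 u = fourier_L1 v"
proof
  fix w
  have m: "(\<lambda>x. exp (- \<i> * complex_of_real w * complex_of_real x)) \<in> borel_measurable lebesgue"
    by (rule measurable_completion) measurable
  have "(LINT x|lebesgue. u x * exp (- \<i> * complex_of_real w * complex_of_real x))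
      = (LINT x|lebesgue. v x * exp (- \<i> * complex_of_real w * complex_of_real x))"
    using assms(1) by (intro integral_cong_AE borel_measurable_times m assms(2,3)) auto
  then show "fourier_L1 u w = fourier_L1 v w"
    by (simp only: fourier_L1_def)
qed

lemma fourier_L1_eq_fourier:
  assumes [measurable]: "v \<in> borel_measurable borel"
  shows "fourier_L1 v w = of_real (1 / sqrt (2 * pi)) * fourier v w"
  unfolding fourier_L1_def fourier_def by (subst integral_completion) auto

text \<open>Transferred from a Borel representative \<open>v\<close>; the normalization
  \<open>1 / sqrt (2 * pi)\<close> cancels the \<open>2 * pi\<close> of
  \<open>plancherel_borel\<close>.\<close>

theorem plancherel_L1:
  assumes u: "u \<in> L2" and iu: "integrable lebesgue u"
  shows "fourier_L1 u \<in> L2" "L2_norm (fourier_L1 u) = L2_norm u"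
proof -
  have [measurable]: "u \<in> borel_measurable lebesgue" by (rule L2_measurable[OF u])
  obtain v where v [measurable]: "v \<in> borel_measurable borel" and eq: "AE x in lebesgue. u x = v x"
    using lebesgue_ex_borel[of u] by auto
  have [measurable]: "v \<in> borel_measurable lebesgue" by (rule measurable_completion) simp
  have "integrable lebesgue v"
    using iu eq integrable_cong_AE[of u lebesgue v] by auto
  then have iv: "integrable lborel v" by (simp add: integrable_completion)
  have "integrable lebesgue (\<lambda>x. (cmod (v x))\<^sup>2)"
    using L2_integrable[OF u] eq by (subst integrable_cong_AE[of _ _ "\<lambda>x. (cmod (u x))\<^sup>2"]) auto
  then have iv2: "integrable lborel (\<lambda>x. (cmod (v x))\<^sup>2)" by (simp add: integrable_completion)
  have F: "fourier_L1 u = (\<lambda>w. of_real (1 / sqrt (2 * pi)) * fourier v w)"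
    unfolding fourier_L1_cong_AE[OF eq \<open>u \<in> borel_measurable lebesgue\<close> \<open>v \<in> borel_measurable lebesgue\<close>]
    by (rule ext, rule fourier_L1_eq_fourier) simp
  have [measurable]: "fourier v \<in> borel_measurable lebesgue" by (rule measurable_completion) simp
  have FL2: "fourier v \<in> L2"
    using plancherel_borel(1)[OF iv iv2] by (intro L2I) (auto simp: integrable_completion)
  then show "fourier_L1 u \<in> L2"
    unfolding F by (rule L2_cmult)
  have "L2_norm (fourier v) = sqrt (2 * pi) * L2_norm v"
    unfolding L2_norm_def using plancherel_borel(2)[OF iv iv2]
    by (simp add: integral_completion real_sqrt_mult)
  then have "L2_norm (fourier_L1 u) = L2_norm v"
    unfolding F L2_norm_cmult by (simp add: norm_divide)
  also have "\<dots> = L2_norm u"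
    using eq by (intro L2_norm_cong_AE) auto
  finally show "L2_norm (fourier_L1 u) = L2_norm u" .
qed

section \<open>The unitary extension of the Fourier transform\<close>

lemma L2_norm_tendsto:
  assumes "\<And>n. u n \<in> L2" "f \<in> L2" "(\<lambda>n. L2_norm (\<lambda>x. u n x - f x)) \<longlonglongrightarrow> 0"
  shows "(\<lambda>n. L2_norm (u n)) \<longlonglongrightarrow> L2_norm f"
proof (rule LIM_zero_cancel, rule Lim_null_comparison[OF always_eventually assms(3)], rule allI)
  show "norm (L2_norm (u n) - L2_norm f) \<le> L2_norm (\<lambda>x. u n x - f x)" for n
    using L2_norm_triangle_diff[OF assms(1,2)] by simp
qed

text \<open>The approximants satisfy the isometry, and norms pass to both limits. It is stated for
  the relation so that it applies to any representative, in particular to the explicit transforms of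
  modulated functions.\<close>

lemma is_fourier_L2_norm:
  assumes "is_fourier_L2 f g"
  shows "L2_norm g = L2_norm f"
proof -
  from assms obtain u where u: "\<And>n. u n \<in> L2" "\<And>n. integrable lebesgue (u n)" "\<And>n. fourier_L1 (u n) \<in> L2"
    and lim: "(\<lambda>n. L2_norm (\<lambda>x. u n x - f x)) \<longlonglongrightarrow> 0"
      "(\<lambda>n. L2_norm (\<lambda>w. fourier_L1 (u n) w - g w)) \<longlonglongrightarrow> 0"
    and fg: "f \<in> L2" "g \<in> L2"
    unfolding is_fourier_L2_def by auto
  have "(\<lambda>n. L2_norm (u n)) \<longlonglongrightarrow> L2_norm g"
    using L2_norm_tendsto[OF u(3) fg(2) lim(2)] by (simp add: plancherel_L1(2) u)
  with L2_norm_tendsto[OF u(1) fg(1) lim(1)] show ?thesis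
    by (simp add: LIMSEQ_unique)
qed

lemma modulation_measurable [measurable]:
  "(\<lambda>x. exp (\<i> * complex_of_real s * complex_of_real x) + c) \<in> borel_measurable lebesgue"
  by (rule measurable_completion) measurable

lemma norm_modulation_le: "cmod (exp (\<i> * complex_of_real s * complex_of_real x) + c) \<le> 1 + cmod c"
  using norm_triangle_ineq[of "exp (\<i> * complex_of_real s * complex_of_real x)" c] by simp

lemma integrable_fourier_L1_kernel:
  assumes "integrable lebesgue u"
  shows "integrable lebesgue (\<lambda>x. u x * exp (- \<i> * complex_of_real w * complex_of_real x))"
proof -
  have "(\<lambda>x. exp (- \<i> * complex_of_real w * complex_of_real x)) \<in> borel_measurable lebesgue"
    by (rule measurable_completion) measurable
  from integrable_mult_bounded(1)[OF assms this, of 1] show ?thesis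
    by simp
qed

lemma fourier_L1_modulation:
  assumes u: "integrable lebesgue u"
  shows "fourier_L1 (\<lambda>x. (exp (\<i> * complex_of_real s * complex_of_real x) + c) * u x) w
    = fourier_L1 u (w - s) + c * fourier_L1 u w"
proof -
  have "(LINT x|lebesgue. (exp (\<i> * complex_of_real s * complex_of_real x) + c) * u x * exp (- \<i> * complex_of_real w * complex_of_real x))
      = (LINT x|lebesgue. u x * exp (- \<i> * complex_of_real (w - s) * complex_of_real x)
          + c * (u x * exp (- \<i> * complex_of_real w * complex_of_real x)))"
    by (intro Bochner_Integration.integral_cong refl) (simp add: algebra_simps flip: exp_add)
  also have "\<dots> = (LINT x|lebesgue. u x * exp (- \<i> * complex_of_real (w - s) * complex_of_real x))
      + c * (LINT x|lebesgue. u x * exp (- \<i> * complex_of_real w * complex_of_real x))"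
    by (simp only: Bochner_Integration.integral_add[OF integrable_fourier_L1_kernel[OF u]
      integrable_mult_right[OF integrable_fourier_L1_kernel[OF u]]] integral_mult_right_zero)
  finally show ?thesis
    unfolding fourier_L1_def by (simp only: distrib_left mult.left_commute)
qed

lemma fourier_L1_diff:
  assumes "integrable lebesgue u" "integrable lebesgue v"
  shows "fourier_L1 (\<lambda>x. u x - v x) w = fourier_L1 u w - fourier_L1 v w"
  unfolding fourier_L1_def left_diff_distrib
  by (subst Bochner_Integration.integral_diff[OF integrable_fourier_L1_kernel[OF assms(1)] integrable_fourier_L1_kernel[OF assms(2)]])
    (simp add: algebra_simps)

text \<open>The constant \<open>c\<close> is part of the multiplier so that differences
  \<open>exp (\<i> s x) f - c f\<close> are covered by one approximating sequence. The multiplier is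
  bounded by \<open>1 + |c|\<close>, and so is the corresponding operation on transforms, hence both
  convergences persist.\<close>

lemma is_fourier_L2_modulation:
  assumes fg: "is_fourier_L2 f g"
  shows "is_fourier_L2 (\<lambda>x. (exp (\<i> * complex_of_real s * complex_of_real x) + c) * f x) (\<lambda>w. g (w - s) + c * g w)"
proof -
  let ?m = "\<lambda>x. exp (\<i> * complex_of_real s * complex_of_real x) + c"
  from fg obtain u where u: "\<And>n. u n \<in> L2" "\<And>n. integrable lebesgue (u n)" "\<And>n. fourier_L1 (u n) \<in> L2"
    and lim: "(\<lambda>n. L2_norm (\<lambda>x. u n x - f x)) \<longlonglongrightarrow> 0"
      "(\<lambda>n. L2_norm (\<lambda>w. fourier_L1 (u n) w - g w)) \<longlonglongrightarrow> 0"
    and f: "f \<in> L2" and g: "g \<in> L2"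
    unfolding is_fourier_L2_def by auto
  note mL2 = L2_mult_bounded[OF _ modulation_measurable norm_modulation_le]
  have F: "fourier_L1 (\<lambda>x. ?m x * u n x) = (\<lambda>w. fourier_L1 (u n) (w - s) + c * fourier_L1 (u n) w)" for n
    by (rule ext) (rule fourier_L1_modulation[OF u(2)])
  have 1: "(\<lambda>n. L2_norm (\<lambda>x. ?m x * u n x - ?m x * f x)) \<longlonglongrightarrow> 0"
  proof (rule Lim_null_comparison[OF always_eventually tendsto_mult_right_zero[OF lim(1)]], rule allI)
    show "norm (L2_norm (\<lambda>x. ?m x * u n x - ?m x * f x)) \<le> (1 + cmod c) * L2_norm (\<lambda>x. u n x - f x)" for n
      using mL2(2)[OF L2_diff[OF u(1) f], of s c n] by (simp add: right_diff_distrib)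
  qed
  have 2: "(\<lambda>n. L2_norm (\<lambda>w. fourier_L1 (\<lambda>x. ?m x * u n x) w - (g (w - s) + c * g w))) \<longlonglongrightarrow> 0"
  proof (rule Lim_null_comparison[OF always_eventually tendsto_mult_right_zero[OF lim(2)]], rule allI)
    fix n
    let ?d = "\<lambda>w. fourier_L1 (u n) w - g w"
    have d: "?d \<in> L2" by (rule L2_diff[OF u(3) g])
    have "L2_norm (\<lambda>w. ?d (w - s) + c * ?d w) \<le> L2_norm (\<lambda>w. ?d (w - s)) + L2_norm (\<lambda>w. c * ?d w)"
      by (rule L2_norm_triangle[OF L2_translate(1)[OF d] L2_cmult[OF d]])
    also have "\<dots> = (1 + cmod c) * L2_norm ?d"
      using L2_translate(2)[OF d, of s] by (simp add: L2_norm_cmult distrib_right)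
    finally show "norm (L2_norm (\<lambda>w. fourier_L1 (\<lambda>x. ?m x * u n x) w - (g (w - s) + c * g w)))
        \<le> (1 + cmod c) * L2_norm ?d"
      unfolding F by (simp add: algebra_simps)
  qed
  show ?thesis
    unfolding is_fourier_L2_def
  proof (intro conjI exI allI)
    show "(\<lambda>n. L2_norm (\<lambda>x. ?m x * u n x - ?m x * f x)) \<longlonglongrightarrow> 0" by (rule 1)
    show "(\<lambda>n. L2_norm (\<lambda>w. fourier_L1 (\<lambda>x. ?m x * u n x) w - (g (w - s) + c * g w))) \<longlonglongrightarrow> 0" by (rule 2)
    show "fourier_L1 (\<lambda>x. ?m x * u n x) \<in> L2" for n
      unfolding F by (rule L2_add[OF L2_translate(1)[OF u(3)] L2_cmult[OF u(3)]])
    show "integrable lebesgue (\<lambda>x. ?m x * u n x)" for n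
      by (rule integrable_mult_bounded(2)[OF u(2) modulation_measurable norm_modulation_le])
    show "(\<lambda>w. g (w - s) + c * g w) \<in> L2"
      by (rule L2_add[OF L2_translate(1)[OF g] L2_cmult[OF g]])
  qed (rule mL2(1)[OF u(1)] mL2(1)[OF f])+
qed

text \<open>Truncations of \<open>f\<close> to \<open>[-n, n]\<close> are integrable and converge to
  \<open>f\<close> in \<open>L2\<close>. By the isometry their transforms form a Cauchy sequence,
  and completeness supplies a limit, so the choice in \<open>fourier_L2\<close> has a
  witness.\<close>

theorem is_fourier_L2_fourier_L2:
  assumes f: "f \<in> L2"
  shows "is_fourier_L2 f (fourier_L2 f)"
proof -
  have [measurable]: "f \<in> borel_measurable lebesgue" by (rule L2_measurable[OF f])
  define u where "u n x = indicator {- real n..real n} x * f x" for n :: nat and x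
  have ind: "(\<lambda>x. indicator {- real n..real n} x :: complex) \<in> borel_measurable lebesgue" for n
    by (rule measurable_completion) measurable
  have u: "u n \<in> L2" for n
    unfolding u_def by (rule L2_mult_bounded(1)[OF f ind, where K = 1]) (simp add: indicator_def)
  have iu: "integrable lebesgue (u n)" for n
  proof (rule Bochner_Integration.integrable_bound)
    have "integrable lborel (\<lambda>x. indicator {- real n..real n} x :: real)"
      by (intro integrable_real_indicator) auto
    then show "integrable lebesgue (\<lambda>x. indicator {- real n..real n} x + (cmod (f x))\<^sup>2)"
      using L2_integrable[OF f] by (simp add: integrable_completion)
    show "u n \<in> borel_measurable lebesgue" by (rule L2_measurable[OF u])
    \<comment> \<open>Inside the window this gives \<open>|f| \<le> 1 + |f|^2\<close>, which is
      integrable there.\<close>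
    have "y \<le> 1 + y\<^sup>2" for y :: real
      using zero_le_power2[of "y - 1"] zero_le_power2[of y]
      by (simp add: power2_diff del: zero_le_power2; linarith)
    then show "AE x in lebesgue. cmod (u n x) \<le> norm (indicator {- real n..real n} x + (cmod (f x))\<^sup>2)"
      by (auto simp: u_def indicator_def)
  qed
  have lim: "(\<lambda>n. L2_norm (\<lambda>x. u n x - f x)) \<longlonglongrightarrow> 0"
  proof -
    have "(\<lambda>n. LINT x|lebesgue. (cmod (u n x - f x))\<^sup>2) \<longlonglongrightarrow> (LINT x::real|lebesgue. (0::real))"
    proof (rule integral_dominated_convergence[where w = "\<lambda>x. (cmod (f x))\<^sup>2"])
      show "AE x in lebesgue. (\<lambda>n. (cmod (u n x - f x))\<^sup>2) \<longlonglongrightarrow> 0"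
      proof (intro AE_I2 tendsto_eventually)
        fix x
        have "\<forall>\<^sub>F n in sequentially. real n \<ge> \<bar>x\<bar>"
          using filterlim_real_sequentially by (auto simp: filterlim_at_top)
        then show "\<forall>\<^sub>F n in sequentially. (cmod (u n x - f x))\<^sup>2 = 0"
          by eventually_elim (auto simp: u_def indicator_def)
      qed
      show "AE x in lebesgue. norm ((cmod (u n x - f x))\<^sup>2) \<le> (cmod (f x))\<^sup>2" for n
        by (auto simp: u_def indicator_def)
    qed (use L2_integrable[OF f] L2_measurable[OF u] in auto)
    then have "(\<lambda>n. sqrt (LINT x|lebesgue. (cmod (u n x - f x))\<^sup>2)) \<longlonglongrightarrow> sqrt 0"
      by (intro tendsto_real_sqrt) simp
    then show ?thesis by (simp add: L2_norm_def)
  qed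
  have F: "fourier_L1 (u n) \<in> L2" for n by (rule plancherel_L1(1)[OF u iu])
  have Fdiff: "L2_norm (\<lambda>w. fourier_L1 (u m) w - fourier_L1 (u n) w) = L2_norm (\<lambda>x. u m x - u n x)" for m n
    using plancherel_L1(2)[OF L2_diff[OF u u] Bochner_Integration.integrable_diff[OF iu iu], of m n]
    by (simp add: fourier_L1_diff[OF iu iu, abs_def])
  obtain g where g: "g \<in> L2" "(\<lambda>n. L2_norm (\<lambda>w. fourier_L1 (u n) w - g w)) \<longlonglongrightarrow> 0"
  proof (rule L2_complete[of "\<lambda>n. fourier_L1 (u n)"])
    fix e :: real assume "e > 0"
    then obtain N where N: "\<And>n. n \<ge> N \<Longrightarrow> L2_norm (\<lambda>x. u n x - f x) < e / 2"
      using LIMSEQ_D[OF lim, of "e / 2"] by auto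
    have "L2_norm (\<lambda>x. u m x - u n x) < e" if "m \<ge> N" "n \<ge> N" for m n
      using L2_norm_triangle[OF L2_diff[OF u f] L2_diff[OF f u], of m n] N[OF that(1)] N[OF that(2)]
        L2_norm_minus_commute[of "u n" f] by simp
    then show "\<exists>N. \<forall>m\<ge>N. \<forall>n\<ge>N. L2_norm (\<lambda>w. fourier_L1 (u m) w - fourier_L1 (u n) w) < e"
      unfolding Fdiff by blast
  qed (use F in auto)
  have "is_fourier_L2 f g"
    unfolding is_fourier_L2_def using f g u iu F lim by blast
  then show ?thesis
    unfolding fourier_L2_def by (rule someI[where P = "is_fourier_L2 f"])
qed

section \<open>The flipping operator\<close>

text \<open>The integrand has modulus \<open>exp (- t * Im a)\<close>, so it decays. With
  \<open>l = \<i> * (a - x)\<close> the antiderivative \<open>exp (t * l) / l\<close> vanishes at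
  infinity and equals \<open>1 / l\<close> at 0.\<close>

lemma laplace_exp:
  assumes a: "Im a > 0"
  shows "set_integrable lborel {0<..} (\<lambda>t. exp (\<i> * complex_of_real t * (a - complex_of_real x)))"
    and "(LBINT t:{0<..}. exp (\<i> * complex_of_real t * (a - complex_of_real x))) = - \<i> / (complex_of_real x - a)"
proof -
  define l where "l = \<i> * (a - complex_of_real x)"
  have l: "Re l = - Im a" "l \<noteq> 0" using a by (auto simp: l_def complex_eq_iff)
  have eq: "exp (\<i> * complex_of_real t * (a - complex_of_real x)) = exp (complex_of_real t * l)" for t
    by (simp add: l_def mult_ac)
  have nexp: "cmod (exp (complex_of_real t * l)) = exp (- (t * Im a))" for t
    by (simp add: norm_exp_eq_Re l)
  have int: "set_integrable lborel {0<..} (\<lambda>t. exp (complex_of_real t * l))"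
    unfolding set_integrable_def
    by (rule Bochner_Integration.integrable_bound[OF integrable_I0i_exp_mscale[OF a, unfolded set_integrable_def]])
      (auto simp: nexp l)
  then show "set_integrable lborel {0<..} (\<lambda>t. exp (\<i> * complex_of_real t * (a - complex_of_real x)))"
    by (simp add: eq)
  have "(LBINT t=0..\<infinity>. exp (complex_of_real t * l)) = 0 - 1 / l"
  proof (rule interval_integral_FTC_integrable)
    show "((\<lambda>t. exp (complex_of_real t * l) / l) has_vector_derivative exp (complex_of_real t * l)) (at t)" for t
    proof -
      have "((\<lambda>z. exp (z * l) / l) has_field_derivative exp (complex_of_real t * l)) (at (complex_of_real t))"
        using l(2) by (auto intro!: derivative_eq_intros)
      then show ?thesis by (rule has_vector_derivative_real_field)
    qed
    show "isCont (\<lambda>t. exp (complex_of_real t * l)) t" for t by (intro continuous_intros)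
    show "set_integrable lborel (einterval 0 \<infinity>) (\<lambda>t. exp (complex_of_real t * l))"
      using int by (simp add: einterval_eq_Ici zero_ereal_def)
    have "((\<lambda>t. exp (complex_of_real t * l) / l) \<longlongrightarrow> exp (complex_of_real 0 * l) / l) (at_right 0)"
      using l(2) by (intro tendsto_intros)
    then show "(((\<lambda>t. exp (complex_of_real t * l) / l) \<circ> real_of_ereal) \<longlongrightarrow> 1 / l) (at_right 0)"
      unfolding zero_ereal_def ereal_tendsto_simps1 by simp
    have "((\<lambda>t. exp (complex_of_real t * l) / l) \<longlongrightarrow> 0) at_top"
    proof (rule tendsto_norm_zero_cancel)
      have "filterlim (\<lambda>t. Im a * t) at_top at_top"
        using a by (intro filterlim_tendsto_pos_mult_at_top[OF tendsto_const _ filterlim_ident])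
      then have bot: "filterlim (\<lambda>t. - (t * Im a)) at_bot at_top"
        by (simp add: filterlim_uminus_at_bot mult.commute)
      have "((\<lambda>t. exp (- (t * Im a)) / cmod l) \<longlongrightarrow> 0 / cmod l) at_top"
        using l(2) by (intro tendsto_divide tendsto_const filterlim_compose[OF exp_at_bot bot]) simp
      then show "((\<lambda>t. cmod (exp (complex_of_real t * l) / l)) \<longlongrightarrow> 0) at_top"
        by (simp add: norm_divide nexp l(1))
    qed
    then show "(((\<lambda>t. exp (complex_of_real t * l) / l) \<circ> real_of_ereal) \<longlongrightarrow> 0) (at_left \<infinity>)"
      by (simp only: ereal_tendsto_simps1)
  qed auto
  then show "(LBINT t:{0<..}. exp (\<i> * complex_of_real t * (a - complex_of_real x))) = - \<i> / (complex_of_real x - a)"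
    using l(2) by (simp add: eq interval_lebesgue_integral_0_infty) (simp add: l_def field_simps)
qed

text \<open>The representation \<open>1 / (x - a) = \<i> \<integral> exp (\<i> t (a - x)) dt\<close> over \<open>t > 0\<close> turns the left-hand side into
  an average of the Fourier coefficients of \<open>G\<close> at the frequencies \<open>\<beta> - t\<close>.\<close>

lemma cauchy_kernel_bound:
  fixes G :: "real \<Rightarrow> real"
  assumes G: "integrable lborel G" and nonneg: "\<And>x. G x \<ge> 0" and a: "Im a > 0" and K: "K \<ge> 0"
    and zero: "\<And>s. \<bar>s\<bar> > K \<Longrightarrow> (LINT x|lborel. exp (\<i> * complex_of_real s * complex_of_real x) * of_real (G x)) = 0"
  shows "cmod (LINT x|lborel. exp (\<i> * complex_of_real \<beta> * complex_of_real x) / (complex_of_real x - a) * of_real (G x))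
    \<le> min (2 * K) (1 / Im a) * (LINT x|lborel. G x)"
proof -
  have [measurable]: "G \<in> borel_measurable borel" using G by auto
  define N where "N = (LINT x|lborel. G x)"
  have N: "N \<ge> 0" using nonneg by (simp add: N_def)
  define c where "c s = (LINT x|lborel. exp (\<i> * complex_of_real s * complex_of_real x) * of_real (G x))" for s
  \<comment> \<open>One majorant records both the trivial bound \<open>N\<close> on the coefficients
    and their vanishing outside \<open>[-K, K]\<close>.\<close>
  have c_le: "cmod (c s) \<le> N * indicator {-K..K} s" for s
  proof (cases "\<bar>s\<bar> > K")
    case True
    then show ?thesis using zero[OF True] N by (simp add: c_def)
  next
    case False
    have "cmod (c s) \<le> (LINT x|lborel. cmod (exp (\<i> * complex_of_real s * complex_of_real x) * of_real (G x)))"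
      unfolding c_def by (rule integral_norm_bound)
    also have "\<dots> = N" using nonneg by (simp add: norm_mult N_def)
    moreover have "s \<in> {-K..K}" using False by auto
    ultimately show ?thesis by simp
  qed
  define e where "e t = indicator {0<..} t * exp (- (t * Im a))" for t :: real
  have e: "integrable lborel e" "(LINT t|lborel. e t) = 1 / Im a"
    using integrable_I0i_exp_mscale[OF a] LBINT_I0i_exp_mscale[OF a]
    by (simp_all add: set_integrable_def e_def[abs_def] interval_lebesgue_integral_0_infty set_lebesgue_integral_def)
  have [measurable]: "e \<in> borel_measurable borel" using e(1) by auto
  define k where "k x t = exp (\<i> * complex_of_real \<beta> * complex_of_real x) * of_real (G x) *
      (indicator {0<..} t *\<^sub>R exp (\<i> * complex_of_real t * (a - complex_of_real x)))" for x t :: real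
  have nk: "cmod (k x t) = G x * e t" for x t
    using nonneg[of x] by (simp add: k_def e_def norm_mult norm_exp_eq_Re abs_mult indicator_def)
  have [measurable]: "case_prod k \<in> borel_measurable (borel \<Otimes>\<^sub>M borel)"
    unfolding k_def by measurable
  have ik: "integrable (lborel \<Otimes>\<^sub>M lborel) (case_prod k)"
  proof (rule lborel_pair.Fubini_integrable)
    show "integrable lborel (\<lambda>x. LINT t|lborel. cmod (case_prod k (x, t)))"
      using G by (simp add: nk)
    show "AE x in lborel. integrable lborel (\<lambda>t. case_prod k (x, t))"
    proof (rule AE_I2)
      show "integrable lborel (\<lambda>t. case_prod k (x, t))" for x
        unfolding k_def prod.case
        by (intro integrable_mult_right laplace_exp(1)[OF a, unfolded set_integrable_def])
    qed
  qed measurable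
  have kx: "(LINT x|lborel. k x t) = (indicator {0<..} t *\<^sub>R exp (\<i> * complex_of_real t * a)) * c (\<beta> - t)" for t
    unfolding c_def k_def integral_mult_right_zero[symmetric]
    by (intro Bochner_Integration.integral_cong refl) (simp add: algebra_simps flip: exp_add)
  have kt: "(LINT t|lborel. k x t) = - \<i> * (exp (\<i> * complex_of_real \<beta> * complex_of_real x) / (complex_of_real x - a) * of_real (G x))" for x
    using laplace_exp(2)[OF a, of x] unfolding k_def integral_mult_right_zero set_lebesgue_integral_def by simp
  have bound_le: "cmod (LINT x|lborel. k x t) \<le> N * (e t * indicator {\<beta> - K..\<beta> + K} t)" for t
  proof -
    have "cmod (LINT x|lborel. k x t) = e t * cmod (c (\<beta> - t))"
      unfolding kx by (simp add: norm_mult e_def norm_exp_eq_Re)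
    also have "\<dots> \<le> e t * (N * indicator {-K..K} (\<beta> - t))"
      by (intro mult_left_mono c_le) (simp add: e_def)
    also have "indicator {-K..K} (\<beta> - t) = (indicator {\<beta> - K..\<beta> + K} t :: real)"
      by (auto simp: indicator_def)
    finally show ?thesis by (simp add: mult_ac)
  qed
  have ie: "integrable lborel (\<lambda>t. e t * indicator {\<beta> - K..\<beta> + K} t)"
    by (rule Bochner_Integration.integrable_bound[OF e(1)]) (auto simp: indicator_def)
  have "cmod (LINT x|lborel. exp (\<i> * complex_of_real \<beta> * complex_of_real x) / (complex_of_real x - a) * of_real (G x))
      = cmod (LINT x|lborel. LINT t|lborel. k x t)"
    unfolding kt integral_mult_right_zero by (simp add: norm_mult)
  also have "\<dots> = cmod (LINT t|lborel. LINT x|lborel. k x t)"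
    using lborel_pair.Fubini_integral[OF ik] by simp
  also have "\<dots> \<le> (LINT t|lborel. cmod (LINT x|lborel. k x t))"
    by (rule integral_norm_bound)
  also have "\<dots> \<le> (LINT t|lborel. N * (e t * indicator {\<beta> - K..\<beta> + K} t))"
    using ie bound_le lborel_pair.integrable_snd[OF ik] by (intro integral_mono) auto
  also have "\<dots> = N * (LINT t|lborel. e t * indicator {\<beta> - K..\<beta> + K} t)" by simp
  \<comment> \<open>The two entries of the minimum: the window has length \<open>2 * K\<close> and
    \<open>e \<le> 1\<close>, while \<open>e\<close> has total mass \<open>1 / Im a\<close>.\<close>
  also have "\<dots> \<le> N * min (2 * K) (1 / Im a)"
  proof (intro mult_left_mono N min.boundedI)
    have "(LINT t|lborel. e t * indicator {\<beta> - K..\<beta> + K} t) \<le> (LINT t|lborel. indicator {\<beta> - K..\<beta> + K} t)"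
    proof (intro integral_mono ie)
      show "e t * indicator {\<beta> - K..\<beta> + K} t \<le> indicator {\<beta> - K..\<beta> + K} t" for t
        using a by (auto simp: e_def indicator_def)
      show "integrable lborel (\<lambda>t. indicator {\<beta> - K..\<beta> + K} t :: real)"
        by (intro integrable_real_indicator) (auto simp: emeasure_lborel_Icc_eq)
    qed
    also have "\<dots> = 2 * K" using K by simp
    finally show "(LINT t|lborel. e t * indicator {\<beta> - K..\<beta> + K} t) \<le> 2 * K" .
    have "(LINT t|lborel. e t * indicator {\<beta> - K..\<beta> + K} t) \<le> (LINT t|lborel. e t)"
      by (intro integral_mono ie e) (auto simp: e_def indicator_def)
    then show "(LINT t|lborel. e t * indicator {\<beta> - K..\<beta> + K} t) \<le> 1 / Im a"
      by (simp add: e)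
  qed
  finally show ?thesis by (simp add: N_def mult.commute)
qed

section \<open>Frequency supports and the Fourier coefficients of \<open>|f|^2\<close>\<close>

lemma AE_zero_outside_ess_support: "AE w in lebesgue. w \<notin> ess_support F \<longrightarrow> F w = 0"
proof -
  let ?U = "{U. open U \<and> (AE w in lebesgue. w \<in> U \<longrightarrow> F w = 0)}"
  \<comment> \<open>The complement of the support is an uncountable union; by Lindelof countably
    many of the open sets already cover it, so the exceptional null sets can be united.\<close>
  obtain \<U> where \<U>: "\<U> \<subseteq> ?U" "countable \<U>" "\<Union>\<U> = \<Union>?U"
    using Lindelof[of ?U] by auto
  then have "AE w in lebesgue. \<forall>U\<in>\<U>. w \<in> U \<longrightarrow> F w = 0"
    by (subst AE_ball_countable) auto
  then show ?thesis
  proof eventually_elim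
    case (elim w)
    then have "w \<in> \<Union>\<U> \<longrightarrow> F w = 0" by blast
    then show ?case unfolding \<U>(3) ess_support_def by blast
  qed
qed

lemma AE_lebesgue_translate:
  assumes "AE x in lebesgue. P (x :: real)"
  shows "AE x in lebesgue. P (x - s)"
proof -
  have "AE x in lborel. P x" using assms by (simp add: AE_completion_iff)
  \<comment> \<open>\<open>P\<close> may fail to be measurable, so its exceptional set is enclosed
    in a Borel null set before translating.\<close>
  then obtain N where N: "N \<in> null_sets lborel" "{x. \<not> P x} \<subseteq> N"
    by (auto elim: AE_E3 simp: eventually_ae_filter)
  have [measurable]: "N \<in> sets borel" using N by auto
  have "AE x in lborel. x \<notin> N" by (rule AE_not_in[OF N(1)])
  then have "AE x in lborel. - s + 1 * x \<notin> N"
    by (intro AE_borel_affine) auto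
  then have "AE x in lborel. P (x - s)"
    by eventually_elim (use N(2) in auto)
  then show ?thesis by (rule AE_completion)
qed

lemma integrable_unimodular_mult:
  assumes f: "f \<in> L2" and m: "m \<in> borel_measurable lebesgue" and m1: "\<And>x. cmod (m x) \<le> 1"
  shows "integrable lebesgue (\<lambda>x. m x * of_real ((cmod (f x))\<^sup>2))"
  by (rule integrable_mult_bounded(2)[OF _ m m1])
    (simp only: complex_of_real_integrable_eq L2_integrable[OF f])

text \<open>Pointwise \<open>|m - c|^2 = 2 - 2 Re (cnj c * m)\<close>, as both numbers are
  unimodular. It serves for the pure character as well as for the full flipping factor.\<close>

lemma L2_norm_unimodular_diff:
  assumes f: "f \<in> L2" and [measurable]: "m \<in> borel_measurable lebesgue" and m: "\<And>x. cmod (m x) = 1" and c: "cmod c = 1"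
  shows "(L2_norm (\<lambda>x. m x * f x - c * f x))\<^sup>2
    = 2 * (L2_norm f)\<^sup>2 - 2 * Re (cnj c * (LINT x|lebesgue. m x * of_real ((cmod (f x))\<^sup>2)))"
proof -
  have i: "integrable lebesgue (\<lambda>x. m x * of_real ((cmod (f x))\<^sup>2))"
    by (rule integrable_unimodular_mult[OF f]) (auto simp: m)
  have ic: "integrable lebesgue (\<lambda>x. Re (cnj c * (m x * of_real ((cmod (f x))\<^sup>2))))"
    by (intro integrable_Re integrable_mult_right i)
  have pt: "(cmod (m x * f x - c * f x))\<^sup>2
      = 2 * (cmod (f x))\<^sup>2 - 2 * Re (cnj c * (m x * of_real ((cmod (f x))\<^sup>2)))" for x
  proof -
    have "(cmod (m x - c))\<^sup>2 = 2 - 2 * Re (cnj c * m x)"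
      using m[of x] c unfolding cmod_power2 by (simp add: cmod_def power2_eq_square algebra_simps)
    moreover have "m x * f x - c * f x = (m x - c) * f x" by (simp add: algebra_simps)
    moreover have "Re (cnj c * (m x * of_real ((cmod (f x))\<^sup>2))) = Re (cnj c * m x) * (cmod (f x))\<^sup>2"
      by (simp only: mult.assoc[symmetric] Re_complex_of_real times_complex.sel Im_complex_of_real mult_zero_right diff_zero)
    ultimately show ?thesis
      by (simp only: norm_mult power_mult_distrib) (simp add: algebra_simps)
  qed
  have "(L2_norm (\<lambda>x. m x * f x - c * f x))\<^sup>2
      = (LINT x|lebesgue. 2 * (cmod (f x))\<^sup>2) - (LINT x|lebesgue. 2 * Re (cnj c * (m x * of_real ((cmod (f x))\<^sup>2))))"
    unfolding L2_norm_power2 pt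
    by (intro Bochner_Integration.integral_diff integrable_mult_right ic L2_integrable[OF f])
  also have "(LINT x|lebesgue. 2 * Re (cnj c * (m x * of_real ((cmod (f x))\<^sup>2))))
      = 2 * Re (cnj c * (LINT x|lebesgue. m x * of_real ((cmod (f x))\<^sup>2)))"
    by (simp only: integral_mult_right_zero integral_Re[OF integrable_mult_right[OF i]])
  finally show ?thesis by (simp add: L2_norm_power2)
qed

lemma exp_measurable_lebesgue:
  "(\<lambda>x. exp (\<i> * complex_of_real s * complex_of_real x)) \<in> borel_measurable lebesgue"
  by (rule measurable_completion) measurable

lemma L2_norm_modulation_diff:
  assumes fg: "is_fourier_L2 f g"
  shows "L2_norm (\<lambda>x. exp (\<i> * complex_of_real s * complex_of_real x) * f x - c * f x) = L2_norm (\<lambda>w. g (w - s) - c * g w)"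
  using is_fourier_L2_norm[OF is_fourier_L2_modulation[OF fg, of s "- c"]] by (simp add: left_diff_distrib)

text \<open>A shift by more than \<open>2 * L\<close> moves \<open>[-L, L]\<close> off itself, so
  \<open>g (w - s)\<close> and \<open>g w\<close> are almost everywhere not both nonzero, and the
  squared distance of the modulated \<open>f\<close> from \<open>c * f\<close> is
  \<open>2 * (L2_norm f)^2\<close> for every unimodular \<open>c\<close>. Comparison with the
  expanded square gives \<open>Re (cnj c * d) = 0\<close>; \<open>c = 1\<close> and
  \<open>c = \<i>\<close> kill the real and imaginary parts. Only the isometry of norms enters, not
  one of inner products.\<close>

lemma PW_fourier_coefficient_zero:
  assumes f: "f \<in> PW L" and s: "\<bar>s\<bar> > 2 * L"
  shows "(LINT x|lebesgue. exp (\<i> * complex_of_real s * complex_of_real x) * of_real ((cmod (f x))\<^sup>2)) = 0"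
proof -
  define g where "g = fourier_L2 f"
  have fL2: "f \<in> L2" and supp: "ess_support g \<subseteq> {-L..L}" using f by (auto simp: PW_def g_def)
  have fg: "is_fourier_L2 f g" unfolding g_def by (rule is_fourier_L2_fourier_L2[OF fL2])
  then have gL2: "g \<in> L2" by (simp add: is_fourier_L2_def)
  have g0: "AE w in lebesgue. w \<notin> {-L..L} \<longrightarrow> g w = 0"
    using AE_zero_outside_ess_support[of g] by eventually_elim (use supp in auto)
  have disj: "AE w in lebesgue. g (w - s) = 0 \<or> g w = 0"
    using g0 AE_lebesgue_translate[OF g0, of s] by eventually_elim (use s in auto)
  define d where "d = (LINT x|lebesgue. exp (\<i> * complex_of_real s * complex_of_real x) * of_real ((cmod (f x))\<^sup>2))"
  have "Re (cnj c * d) = 0" if c: "cmod c = 1" for c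
  proof -
    note [measurable] = L2_measurable[OF gL2] L2_measurable[OF L2_translate(1)[OF gL2, of s]]
    have "(L2_norm (\<lambda>w. g (w - s) - c * g w))\<^sup>2 = (LINT w|lebesgue. (cmod (g (w - s)))\<^sup>2 + (cmod (g w))\<^sup>2)"
      unfolding L2_norm_power2
    proof (rule integral_cong_AE)
      show "AE w in lebesgue. (cmod (g (w - s) - c * g w))\<^sup>2 = (cmod (g (w - s)))\<^sup>2 + (cmod (g w))\<^sup>2"
        using disj by eventually_elim (auto simp: norm_mult c)
    qed measurable
    also have "\<dots> = (L2_norm (\<lambda>w. g (w - s)))\<^sup>2 + (L2_norm g)\<^sup>2"
      unfolding L2_norm_power2
      by (intro Bochner_Integration.integral_add L2_integrable gL2 L2_translate(1))
    also have "\<dots> = 2 * (L2_norm f)\<^sup>2"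
      by (simp add: L2_translate(2)[OF gL2] is_fourier_L2_norm[OF fg])
    finally show ?thesis
      using L2_norm_unimodular_diff[OF fL2 exp_measurable_lebesgue[of s] _ c]
      by (simp add: L2_norm_modulation_diff[OF fg] d_def)
  qed
  from this[of 1] this[of \<i>] have "d = 0" by (simp add: complex_eq_iff)
  then show ?thesis by (simp add: d_def)
qed

text \<open>The distance is \<open>D s\<close>. In its square one factor is bounded by the modulus
  of continuity and the other by \<open>2 * L2_norm f\<close>; the latter bound also makes the
  supremum meaningful.\<close>

lemma modulation_norm_le_modulus2:
  assumes f: "f \<in> L2" and s: "\<bar>s\<bar> \<le> h"
  shows "(L2_norm (\<lambda>x. exp (\<i> * complex_of_real s * complex_of_real x) * f x - f x))\<^sup>2 \<le> 2 * modulus2 (fourier_L2 f) h * L2_norm f"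
proof -
  define g where "g = fourier_L2 f"
  have fg: "is_fourier_L2 f g" unfolding g_def by (rule is_fourier_L2_fourier_L2[OF f])
  then have gL2: "g \<in> L2" by (simp add: is_fourier_L2_def)
  define D where "D t = L2_norm (\<lambda>w. g (w - t) - g w)" for t
  have D_le: "D t \<le> 2 * L2_norm f" for t
    using L2_norm_triangle[OF L2_translate(1)[OF gL2, of t] L2_cmult[OF gL2, of "- 1"]]
    by (simp add: L2_norm_cmult[of "- 1" g, simplified] L2_translate(2)[OF gL2] is_fourier_L2_norm[OF fg] D_def)
  have "D s \<le> modulus2 g h"
    unfolding modulus2_def D_def[symmetric]
    by (rule cSUP_upper) (use s D_le in \<open>auto intro!: bdd_aboveI2\<close>)
  then have "(D s)\<^sup>2 \<le> (2 * L2_norm f) * modulus2 g h"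
    unfolding power2_eq_square using D_le[of s] by (intro mult_mono) (auto simp: D_def)
  moreover have "L2_norm (\<lambda>x. exp (\<i> * complex_of_real s * complex_of_real x) * f x - f x) = D s"
    using L2_norm_modulation_diff[OF fg, of s 1] by (simp add: D_def)
  ultimately show ?thesis by (simp add: g_def mult_ac)
qed

text \<open>The case \<open>K = 2 * L\<close> of \<open>cauchy_kernel_bound\<close>, with
  \<open>G\<close> a Borel representative of \<open>|f|^2\<close>.\<close>

lemma PW_cauchy_kernel_bound:
  assumes f: "f \<in> PW L" and L: "L > 0" and a: "Im a > 0"
  shows "cmod (LINT x|lebesgue. exp (\<i> * complex_of_real \<beta> * complex_of_real x) / (complex_of_real x - a) * of_real ((cmod (f x))\<^sup>2))
    \<le> min (4 * L) (1 / Im a) * (L2_norm f)\<^sup>2"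
proof -
  have fL2: "f \<in> L2" using f by (simp add: PW_def)
  then have [measurable]: "f \<in> borel_measurable lebesgue" by (rule L2_measurable)
  obtain v where v [measurable]: "v \<in> borel_measurable borel" and eq: "AE x in lebesgue. f x = v x"
    using lebesgue_ex_borel[of f] by auto
  have [measurable]: "v \<in> borel_measurable lebesgue" by (rule measurable_completion) simp
  define G where "G x = (cmod (v x))\<^sup>2" for x
  have [measurable]: "G \<in> borel_measurable borel" unfolding G_def by measurable
  have lint: "(LINT x|lebesgue. m x * of_real ((cmod (f x))\<^sup>2)) = (LINT x|lborel. m x * of_real (G x))"
    if [measurable]: "m \<in> borel_measurable borel" for m :: "real \<Rightarrow> complex"
  proof -
    have [measurable]: "m \<in> borel_measurable lebesgue" by (rule measurable_completion) simp
    have "(LINT x|lebesgue. m x * of_real ((cmod (f x))\<^sup>2)) = (LINT x|lebesgue. m x * of_real (G x))"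
      unfolding G_def using eq by (intro integral_cong_AE) auto
    then show ?thesis by (simp add: integral_completion)
  qed
  have "integrable lebesgue G"
    using L2_integrable[OF fL2] eq unfolding G_def
    by (subst integrable_cong_AE[of _ _ "\<lambda>x. (cmod (f x))\<^sup>2"]) auto
  then have iG: "integrable lborel G" by (simp add: integrable_completion)
  have "(L2_norm f)\<^sup>2 = (LINT x|lebesgue. G x)"
    unfolding L2_norm_power2 G_def using eq by (intro integral_cong_AE) auto
  then have N: "(LINT x|lborel. G x) = (L2_norm f)\<^sup>2" by (simp add: integral_completion)
  have "(LINT x|lborel. exp (\<i> * complex_of_real s * complex_of_real x) * of_real (G x)) = 0" if "\<bar>s\<bar> > 2 * L" for s
    using PW_fourier_coefficient_zero[OF f that] by (subst lint[symmetric]) simp_all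
  then have "cmod (LINT x|lborel. exp (\<i> * complex_of_real \<beta> * complex_of_real x) / (complex_of_real x - a) * of_real (G x))
      \<le> min (2 * (2 * L)) (1 / Im a) * (LINT x|lborel. G x)"
    using L by (intro cauchy_kernel_bound[OF iG _ a]) (auto simp: G_def)
  then show ?thesis
    by (subst lint) (simp_all add: N)
qed

section \<open>The flipping factor and the two estimates\<close>

lemma flipping_factor:
  assumes a: "Im a > 0" and \<beta>: "\<beta> = 2 * Im a / (cmod a)\<^sup>2"
  shows "flipping a f x = a / cnj a * (exp (\<i> * complex_of_real \<beta> * complex_of_real x)
    + 2 * \<i> * Im a * (exp (\<i> * complex_of_real \<beta> * complex_of_real x) / (complex_of_real x - a))) * f x"
proof -
  have nz: "a \<noteq> 0" "cnj a \<noteq> 0" "complex_of_real x - a \<noteq> 0" "a - complex_of_real x \<noteq> 0"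
    using a by (auto simp: complex_eq_iff)
  have aa: "a - cnj a = 2 * \<i> * Im a" by (simp add: complex_eq_iff)
  \<comment> \<open>The exponentials combine to a pure character, since
    \<open>a - cnj a = 2 * \<i> * Im a\<close> and \<open>a * cnj a = |a|^2\<close>; this is where
    \<open>\<beta>\<close> arises.\<close>
  have "complex_of_real x / cnj a - complex_of_real x / a = complex_of_real x * (a - cnj a) / (a * cnj a)"
    using nz by (simp add: field_simps)
  also have "\<dots> = \<i> * complex_of_real \<beta> * complex_of_real x"
    unfolding aa complex_norm_square[symmetric] by (simp add: \<beta>)
  finally have 1: "exp (complex_of_real x / cnj a) / exp (complex_of_real x / a) = exp (\<i> * complex_of_real \<beta> * complex_of_real x)"
    by (simp flip: exp_diff)
  have "(1 - complex_of_real x / cnj a) / (1 - complex_of_real x / a) = a / cnj a * ((complex_of_real x - cnj a) / (complex_of_real x - a))"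
    using nz by (simp add: divide_simps) (simp add: algebra_simps)
  also have "complex_of_real x - cnj a = (complex_of_real x - a) + 2 * \<i> * Im a"
    by (simp flip: aa)
  also have "((complex_of_real x - a) + 2 * \<i> * Im a) / (complex_of_real x - a) = 1 + 2 * \<i> * Im a / (complex_of_real x - a)"
    using nz(3) by (simp add: add_divide_distrib)
  finally show ?thesis
    unfolding flipping_def 1 by (simp add: distrib_left distrib_right mult_ac)
qed

theorem theorem3p3:
  fixes L \<beta> :: real and f :: "real \<Rightarrow> complex" and a :: complex
  assumes "L > 0"
    and "f \<in> PW L"
    and "Im a > 0"
    and "\<beta> = 2 * Im a / (cmod a)\<^sup>2"
  shows "(\<beta> > 2 * L \<longrightarrow>
           \<bar>(INF c\<in>{c. cmod c = 1}. (L2_norm (\<lambda>x. flipping a f x - c * f x))\<^sup>2) - 2 * (L2_norm f)\<^sup>2\<bar>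
             \<le> 30 * (L * Im a) * (L2_norm f)\<^sup>2)
       \<and> (\<beta> \<le> 2 * L \<longrightarrow>
           (INF c\<in>{c. cmod c = 1}. (L2_norm (\<lambda>x. flipping a f x - c * f x))\<^sup>2)
             \<le> 2 * modulus2 (fourier_L2 f) \<beta> * L2_norm f + 8 * sqrt (L * Im a) * (L2_norm f)\<^sup>2)"
proof -
  have fL2: "f \<in> L2" using assms(2) by (simp add: PW_def)
  have \<beta>0: "\<beta> \<ge> 0" using assms(3) by (simp add: assms(4))
  define N where "N = (L2_norm f)\<^sup>2"
  have N: "N \<ge> 0" by (simp add: N_def)
  define e where "e x = exp (\<i> * complex_of_real \<beta> * complex_of_real x)" for x
  \<comment> \<open>The constant phase \<open>b\<close> is split off because the infimum over
    \<open>c\<close> can absorb it.\<close>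
  define b where "b = a / cnj a"
  have b: "cmod b = 1" using assms(3) by (auto simp: b_def norm_divide)
  define m where "m x = e x + 2 * \<i> * Im a * (e x / (complex_of_real x - a))" for x
  have F: "flipping a f x = b * m x * f x" for x
    unfolding flipping_factor[OF assms(3,4)] m_def e_def b_def ..
  have xa: "complex_of_real x - a \<noteq> 0" for x using assms(3) by (auto simp: complex_eq_iff)
  have m1: "cmod (m x) = 1" for x
  proof -
    have "m x = e x * ((complex_of_real x - cnj a) / (complex_of_real x - a))"
    proof -
      have "complex_of_real x - cnj a = (complex_of_real x - a) + 2 * \<i> * Im a" by (simp add: complex_eq_iff)
      then have "(complex_of_real x - cnj a) / (complex_of_real x - a) = 1 + 2 * \<i> * Im a / (complex_of_real x - a)"
        using xa[of x] by (metis add_divide_distrib divide_self)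
      then show ?thesis by (simp add: m_def distrib_left mult_ac)
    qed
    moreover have "cmod (complex_of_real x - cnj a) = cmod (complex_of_real x - a)"
      by (metis complex_cnj_complex_of_real complex_cnj_diff complex_mod_cnj)
    ultimately show ?thesis using xa[of x] by (simp add: norm_mult norm_divide e_def)
  qed
  have e_meas: "e \<in> borel_measurable lebesgue"
    unfolding e_def by (rule exp_measurable_lebesgue)
  have k_meas: "(\<lambda>x. e x / (complex_of_real x - a)) \<in> borel_measurable lebesgue"
    unfolding e_def by (rule measurable_completion) measurable
  have m_meas: "m \<in> borel_measurable lebesgue"
    unfolding m_def by (intro borel_measurable_add e_meas borel_measurable_times k_meas borel_measurable_const)
  define J where "J = (LINT x|lebesgue. m x * of_real ((cmod (f x))\<^sup>2))"
  define D where "D = (LINT x|lebesgue. e x * of_real ((cmod (f x))\<^sup>2))"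
  define R where "R = (LINT x|lebesgue. e x / (complex_of_real x - a) * of_real ((cmod (f x))\<^sup>2))"
  have e1: "cmod (e x) = 1" for x by (simp add: e_def)
  have JDR: "J = D + 2 * \<i> * Im a * R"
  proof -
    have "integrable lebesgue (\<lambda>x. e x / (complex_of_real x - a) * of_real ((cmod (f x))\<^sup>2))"
    proof (rule integrable_mult_bounded(2)[OF _ k_meas])
      show "cmod (e x / (complex_of_real x - a)) \<le> 1 / Im a" for x
        using abs_Im_le_cmod[of "complex_of_real x - a"] assms(3) xa[of x]
        by (simp add: norm_divide e1 divide_simps)
    qed (simp only: complex_of_real_integrable_eq L2_integrable[OF fL2])
    moreover have "integrable lebesgue (\<lambda>x. e x * of_real ((cmod (f x))\<^sup>2))"
      by (rule integrable_unimodular_mult[OF fL2 e_meas]) (simp add: e1)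
    ultimately show ?thesis
      unfolding J_def D_def R_def m_def
      by (simp only: distrib_right mult.assoc Bochner_Integration.integral_add integrable_mult_right integral_mult_right_zero)
  qed
  have R: "cmod R \<le> min (4 * L) (1 / Im a) * N"
    using PW_cauchy_kernel_bound[OF assms(2,1,3), of \<beta>] by (simp add: R_def e_def N_def)
  define Q where "Q c = (L2_norm (\<lambda>x. flipping a f x - c * f x))\<^sup>2" for c
  have Q: "Q c = 2 * N - 2 * Re (cnj c * (b * J))" if "cmod c = 1" for c
  proof -
    have "Q c = 2 * N - 2 * Re (cnj c * (LINT x|lebesgue. b * m x * of_real ((cmod (f x))\<^sup>2)))"
      unfolding Q_def F N_def using m_meas
      by (intro L2_norm_unimodular_diff fL2 that borel_measurable_times borel_measurable_const)
        (auto simp: norm_mult b m1)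
    then show ?thesis by (simp add: J_def mult.assoc)
  qed
  \<comment> \<open>The real infimum is below its members only for a set bounded below. The choice
    \<open>c = b\<close> cancels the phase and gives the upper bound in both regimes.\<close>
  have "bdd_below (Q ` {c. cmod c = 1})"
    by (rule bdd_belowI2[of _ 0]) (simp add: Q_def)
  then have INF_le: "(INF c\<in>{c. cmod c = 1}. Q c) \<le> Q b"
    by (rule cINF_lower) (simp add: b)
  have Qb: "Q b = 2 * N - 2 * Re J"
  proof -
    have "cnj b * (b * J) = of_real ((cmod b)\<^sup>2) * J"
      by (simp only: complex_norm_square mult_ac)
    then have "cnj b * (b * J) = J" by (simp only: b) simp
    then show ?thesis by (simp only: Q[OF b])
  qed
  \<comment> \<open>Here \<open>\<beta>\<close> exceeds the bandwidth of \<open>|f|^2\<close>, so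
    \<open>D = 0\<close> and \<open>J\<close> is the remainder alone. The entry \<open>4 * L\<close>
    of the minimum gives \<open>|J| \<le> 8 * (L * Im a) * N\<close>; every \<open>Q c\<close>
    differs from \<open>2 * N\<close> by at most \<open>2 * |J|\<close>, so the constant is 16,
    within the stated 30.\<close>
  have "\<bar>(INF c\<in>{c. cmod c = 1}. Q c) - 2 * N\<bar> \<le> 30 * (L * Im a) * N" if "\<beta> > 2 * L"
  proof -
    have "D = 0"
      using PW_fourier_coefficient_zero[OF assms(2), of \<beta>] that assms(1) by (simp add: D_def e_def)
    then have "cmod J = 2 * Im a * cmod R"
      using assms(3) by (simp add: JDR norm_mult)
    also have "\<dots> \<le> 2 * Im a * (4 * L * N)"
      using R N assms(3) by (intro mult_left_mono order_trans[OF R] mult_right_mono) auto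
    finally have J: "cmod J \<le> 8 * (L * Im a) * N" by (simp add: mult_ac)
    have LN: "0 \<le> (L * Im a) * N" using assms(1,3) N by simp
    have "2 * N - 2 * cmod J \<le> (INF c\<in>{c. cmod c = 1}. Q c)"
    proof (rule cINF_greatest)
      show "{c. cmod c = 1} \<noteq> {}" using b by auto
      fix c assume "c \<in> {c. cmod c = 1}"
      then have c: "cmod c = 1" by simp
      then have "Re (cnj c * (b * J)) \<le> cmod J"
        using complex_Re_le_cmod[of "cnj c * (b * J)"] b by (simp add: norm_mult)
      then show "2 * N - 2 * cmod J \<le> Q c" using Q[OF c] by simp
    qed
    moreover have "Q b \<le> 2 * N + 2 * cmod J"
      using abs_Re_le_cmod[of J] by (simp add: Qb)
    ultimately show ?thesis using INF_le J LN by (simp add: abs_le_iff)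
  qed
  moreover have "(INF c\<in>{c. cmod c = 1}. Q c) \<le> 2 * modulus2 (fourier_L2 f) \<beta> * L2_norm f + 8 * sqrt (L * Im a) * N"
  proof -
    \<comment> \<open>The expansion with \<open>c = 1\<close>, read backwards, turns the character
      part into the distance between \<open>f\<close> and its modulation.\<close>
    have "2 * N - 2 * Re D = (L2_norm (\<lambda>x. e x * f x - f x))\<^sup>2"
      using L2_norm_unimodular_diff[OF fL2 e_meas e1, of 1] by (simp add: N_def D_def)
    also have "\<dots> \<le> 2 * modulus2 (fourier_L2 f) \<beta> * L2_norm f"
      unfolding e_def using modulation_norm_le_modulus2[OF fL2, of \<beta> \<beta>] \<beta>0 by simp
    finally have 1: "2 * N - 2 * Re D \<le> 2 * modulus2 (fourier_L2 f) \<beta> * L2_norm f" .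
    \<comment> \<open>A minimum is at most the geometric mean. This gives
      \<open>Im a * |R| \<le> 2 * sqrt (L * Im a) * N\<close>; a factor 2 from \<open>J - D\<close>
      and another from \<open>Q b\<close> make up the 8.\<close>
    have "min (4 * L) (1 / Im a) \<le> sqrt (4 * L * (1 / Im a))"
      using assms(1,3)
      by (intro real_le_rsqrt, unfold power2_eq_square, intro mult_mono) auto
    also have "\<dots> = 2 * sqrt (L * Im a) / Im a"
      using assms(1,3) by (simp add: real_sqrt_mult real_sqrt_divide field_simps)
    finally have "cmod R \<le> 2 * sqrt (L * Im a) / Im a * N"
      using R N by (meson mult_right_mono order_trans)
    then have "Im a * cmod R \<le> 2 * sqrt (L * Im a) * N"
      using assms(3) by (simp add: field_simps)
    moreover have "\<bar>Re J - Re D\<bar> \<le> 2 * (Im a * cmod R)"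
      using abs_Re_le_cmod[of "2 * \<i> * Im a * R"] assms(3) by (simp add: JDR norm_mult)
    ultimately have "Q b \<le> 2 * N - 2 * Re D + 8 * sqrt (L * Im a) * N"
      unfolding Qb by (simp add: abs_le_iff)
    with INF_le 1 show ?thesis by linarith
  qed
  ultimately show ?thesis by (simp add: Q_def N_def)
qed

end
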